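(* Let $k,\ell$ be integers with $k\ge 1$ and $0\le \ell\le 2k-1$, let $\Gamma$ be a group, let $(G,\psi)$ be a $\Gamma$-labeled graph, and let $\alpha:2^{\Gamma}\to\{0,1,\dots,\ell\}$ be a normalized polymatroidal function satisfying the following smoothness condition: for all $\emptyset\ne S\subseteq\Gamma$ and $g\in\Gamma$, $$\alpha(S\cup\{g\})-\alpha(S)>k\ \Longrightarrow\ S=\{1_\Gamma\}\text{ and } g^2\ne 1_\Gamma .$$ Define $f_\alpha:\mathcal{C}(G)\to\mathbb{Z}$ by $$f_\alpha(F)=k|V(F)|-\ell+\begin{cases}\min\{\tilde\alpha(F),k\} & \text{if } F \text{ is near-balanced},\\ \tilde\alpha(F) & \text{otherwise.}\end{cases}$$ Then the set $\mathcal{I}_\alpha(G)=\{I\subseteq E(G) : |F|\le f_\alpha(F)\ \text{for all } F\in\mathcal{C}(G)\cap 2^I\}$ is the family of independent sets of a matroid on $E(G)$.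
   Context: Graphs are finite and may have loops and parallel edges. A $\Gamma$-labeled graph $(G,\psi)$ is a directed graph $G=(V,E)$ with a map $\psi:E\to\Gamma$. The orientation is only for reference: one may reverse any edge (including a loop), replacing its label $g$ by $g^{-1}$. Connectivity, walks and cycles refer to the underlying undirected graph. For $F\subseteq E$, $V(F)$ is the set of vertices incident to edges of $F$; $\mathcal{C}(G)$ is the set of nonempty connected edge sets $F\subseteq E$ (i.e. $(V(F),F)$ is connected). The gain $\psi(W)$ of a walk $W=v_0,e_1,v_1,\dots,e_m,v_m$ is $\psi(e_1)^{\sigma(e_1)}\cdots\psi(e_m)^{\sigma(e_m)}$, where $\sigma(e_i)=1$ if $e_i$ is traversed forward and $-1$ otherwise. For $F\in\mathcal{C}(G)$ and $v\in V(F)$, $\langle F\rangle_{v,\psi}$ is the subgroup of $\Gamma$ generated by the gains of all closed walks starting at $v$ using only edges of $F$; for different $v\in V(F)$ these subgroups are conjugate. An edge set is unbalanced if it contains a cycle (loops count as cycles) with non-identity gain, and balanced otherwise; a loop is balanced iff its label is $1_\Gamma$. Let $v$ be a vertex and $\{E_1,E_2\}$ a bipartition (parts may be empty) of the set of non-loop edges incident to $v$. The split of $(G,\psi)$ at $v$ with respect to $\{E_1,E_2\}$ is the $\Gamma$-labeled graph obtained by replacing $v$ by two vertices $v_1,v_2$ such that $v_i$ is incident to the edges in $E_i$ ($i=1,2$), each balanced loop at $v$ becomes a loop at $v_1$, and each unbalanced loop $e$ at $v$ becomes an arc from $v_1$ to $v_2$ keeping its label (since loops can be reversed, the label of this arc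 may be chosen to be either $\psi(e)$ or $\psi(e)^{-1}$). All labels are otherwise kept. $F\in\mathcal{C}(G)$ is near-balanced if it is not balanced and there is a split of $(G,\psi)$ in which $F$ becomes a balanced set. For $S\subseteq\Gamma$, $\langle S\rangle$ is the subgroup generated by $S$. A function $\alpha:2^\Gamma\to\mathbb{Z}$ is polymatroidal if: (c1) $\alpha(\emptyset)=0$; (c2) $\alpha(X)+\alpha(Y)\ge\alpha(X\cup Y)+\alpha(X\cap Y)$ for all $X,Y\subseteq\Gamma$; (c3) $\alpha(X)\le\alpha(Y)$ for $X\subseteq Y\subseteq\Gamma$; (c4) $\alpha(\gamma X\gamma^{-1})=\alpha(X)$ for $X\subseteq\Gamma$, $\gamma\in\Gamma$; (c5) $\alpha(\langle X\rangle)=\alpha(X)$ for $X\subseteq\Gamma$. It is normalized if moreover $\alpha(\{1_\Gamma\})=0$ and $\alpha(\{g\})\ne 0$ for every $g\ne 1_\Gamma$. For $F\in\mathcal{C}(G)$, $\tilde\alpha(F):=\alpha(\langle F\rangle_{v,\psi})$ for any $v\in V(F)$ (independent of $v$ by (c4)). *)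

theory Defs
  imports
    "HOL-Algebra.Generated_Groups"
    "Graph_Theory.Digraph_Component"
    "Graph_Theory.Arc_Walk"
begin

section \<open>Edge sets, walks and gains\<close>

definition edge_verts :: "('v, 'e) pre_digraph \<Rightarrow> 'e set \<Rightarrow> 'v set" where
  "edge_verts G F = tail G ` F \<union> head G ` F"

definition edge_subgraph :: "('v, 'e) pre_digraph \<Rightarrow> 'e set \<Rightarrow> ('v, 'e) pre_digraph" where
  "edge_subgraph G F = G\<lparr>verts := edge_verts G F, arcs := F\<rparr>"

definition connected_edge_sets :: "('v, 'e) pre_digraph \<Rightarrow> 'e set set" where
  "connected_edge_sets G =
     {F. F \<subseteq> arcs G \<and> F \<noteq> {} \<and> Digraph_Component.connected (edge_subgraph G F)}"

text \<open>
  Walks of the underlying undirected graph of \<open>G\<close> are directed arc walks of the following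
  digraph. The arc \<open>(e, True)\<close> is \<open>e\<close> traversed forward, and \<open>(e, False)\<close> is \<open>e\<close> traversed
  backward; a loop can be traversed in either direction.
\<close>

definition two_way :: "('v, 'e) pre_digraph \<Rightarrow> ('v, 'e \<times> bool) pre_digraph" where
  "two_way G =
     \<lparr>verts = verts G, arcs = arcs G \<times> UNIV,
      tail = (\<lambda>(e, fwd). if fwd then tail G e else head G e),
      head = (\<lambda>(e, fwd). if fwd then head G e else tail G e)\<rparr>"

definition gain :: "('g, 'm) monoid_scheme \<Rightarrow> ('e \<Rightarrow> 'g) \<Rightarrow> ('e \<times> bool) list \<Rightarrow> 'g" where
  "gain \<Gamma> \<psi> p =
     foldr (\<lambda>(e, fwd) x. (if fwd then \<psi> e else inv\<^bsub>\<Gamma>\<^esub> (\<psi> e)) \<otimes>\<^bsub>\<Gamma>\<^esub> x) p \<one>\<^bsub>\<Gamma>\<^esub>"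

definition gain_group ::
  "('g, 'm) monoid_scheme \<Rightarrow> ('v, 'e) pre_digraph \<Rightarrow> ('e \<Rightarrow> 'g) \<Rightarrow> 'e set \<Rightarrow> 'v \<Rightarrow> 'g set" where
  "gain_group \<Gamma> G \<psi> F v =
     generate \<Gamma> {gain \<Gamma> \<psi> p | p. pre_digraph.awalk (two_way (edge_subgraph G F)) v p v}"

section \<open>Balanced and near-balanced edge sets\<close>

text \<open>
  The library notion \<^const>\<open>pre_digraph.cycle\<close> only asks for distinct vertices. In
  \<^term>\<open>two_way G\<close> it therefore also holds for an edge traversed back and forth, which is excluded
  here by requiring the edges to be distinct. Two parallel edges do form a cycle, and so does a loop.
\<close>

definition ucycle :: "('v, 'e) pre_digraph \<Rightarrow> ('e \<times> bool) list \<Rightarrow> bool" where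
  "ucycle G p \<longleftrightarrow> pre_digraph.cycle (two_way G) p \<and> distinct (map fst p)"

definition balanced ::
  "('g, 'm) monoid_scheme \<Rightarrow> ('v, 'e) pre_digraph \<Rightarrow> ('e \<Rightarrow> 'g) \<Rightarrow> 'e set \<Rightarrow> bool" where
  "balanced \<Gamma> G \<psi> F \<longleftrightarrow> (\<forall>p. ucycle (edge_subgraph G F) p \<longrightarrow> gain \<Gamma> \<psi> p = \<one>\<^bsub>\<Gamma>\<^esub>)"

definition nonloops_at :: "('v, 'e) pre_digraph \<Rightarrow> 'v \<Rightarrow> 'e set" where
  "nonloops_at G v = {e \<in> arcs G. tail G e \<noteq> head G e \<and> (tail G e = v \<or> head G e = v)}"

definition unbalanced_loops_at ::
  "('g, 'm) monoid_scheme \<Rightarrow> ('v, 'e) pre_digraph \<Rightarrow> ('e \<Rightarrow> 'g) \<Rightarrow> 'v \<Rightarrow> 'e set" where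
  "unbalanced_loops_at \<Gamma> G \<psi> v = {e \<in> arcs G. tail G e = v \<and> head G e = v \<and> \<psi> e \<noteq> \<one>\<^bsub>\<Gamma>\<^esub>}"

datatype 'v split_vertex = Kept 'v | Split1 | Split2

text \<open>
  The split of \<open>G\<close> at \<open>v\<close>, where \<open>E2\<close> is the second part of the bipartition of the non-loop edges
  at \<open>v\<close> and \<open>L\<close> is the set of unbalanced loops at \<open>v\<close>. Edges at \<open>v\<close> that are in neither set (the
  first part of the bipartition and the balanced loops) are attached to \<open>Split1\<close>.
\<close>

definition split_graph ::
  "('v, 'e) pre_digraph \<Rightarrow> 'v \<Rightarrow> 'e set \<Rightarrow> 'e set \<Rightarrow> ('v split_vertex, 'e) pre_digraph" where
  "split_graph G v E2 L =
     \<lparr>verts = Kept ` (verts G - {v}) \<union> {Split1, Split2}, arcs = arcs G,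
      tail = (\<lambda>e. if tail G e \<noteq> v then Kept (tail G e) else if e \<in> E2 then Split2 else Split1),
      head = (\<lambda>e. if head G e \<noteq> v then Kept (head G e)
                  else if e \<in> E2 \<union> L then Split2 else Split1)\<rparr>"

text \<open>
  The set \<open>R\<close> consists of the unbalanced loops at \<open>v\<close> that are reversed before splitting, i.e.
  whose arc from \<open>Split1\<close> to \<open>Split2\<close> gets the inverse label. The choice is made separately for
  each loop.
\<close>

definition near_balanced ::
  "('g, 'm) monoid_scheme \<Rightarrow> ('v, 'e) pre_digraph \<Rightarrow> ('e \<Rightarrow> 'g) \<Rightarrow> 'e set \<Rightarrow> bool" where
  "near_balanced \<Gamma> G \<psi> F \<longleftrightarrow>
     F \<in> connected_edge_sets G \<and> \<not> balanced \<Gamma> G \<psi> F \<and>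
     (\<exists>v E1 E2 R.
        v \<in> verts G \<and> E1 \<union> E2 = nonloops_at G v \<and> E1 \<inter> E2 = {} \<and>
        R \<subseteq> unbalanced_loops_at \<Gamma> G \<psi> v \<and>
        balanced \<Gamma> (split_graph G v E2 (unbalanced_loops_at \<Gamma> G \<psi> v))
          (\<lambda>e. if e \<in> R then inv\<^bsub>\<Gamma>\<^esub> (\<psi> e) else \<psi> e) F)"

section \<open>Polymatroidal functions on a group\<close>

definition polymatroidal :: "('g, 'm) monoid_scheme \<Rightarrow> ('g set \<Rightarrow> int) \<Rightarrow> bool" where
  "polymatroidal \<Gamma> \<alpha> \<longleftrightarrow>
     \<alpha> {} = 0 \<and>
     (\<forall>X Y. X \<subseteq> carrier \<Gamma> \<longrightarrow> Y \<subseteq> carrier \<Gamma> \<longrightarrow> \<alpha> X + \<alpha> Y \<ge> \<alpha> (X \<union> Y) + \<alpha> (X \<inter> Y)) \<and>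
     (\<forall>X Y. X \<subseteq> Y \<longrightarrow> Y \<subseteq> carrier \<Gamma> \<longrightarrow> \<alpha> X \<le> \<alpha> Y) \<and>
     (\<forall>X g. X \<subseteq> carrier \<Gamma> \<longrightarrow> g \<in> carrier \<Gamma> \<longrightarrow>
        \<alpha> ((g <#\<^bsub>\<Gamma>\<^esub> X) #>\<^bsub>\<Gamma>\<^esub> inv\<^bsub>\<Gamma>\<^esub> g) = \<alpha> X) \<and>
     (\<forall>X. X \<subseteq> carrier \<Gamma> \<longrightarrow> \<alpha> (generate \<Gamma> X) = \<alpha> X)"

definition normalized_polymatroidal :: "('g, 'm) monoid_scheme \<Rightarrow> ('g set \<Rightarrow> int) \<Rightarrow> bool" where
  "normalized_polymatroidal \<Gamma> \<alpha> \<longleftrightarrow>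
     polymatroidal \<Gamma> \<alpha> \<and> \<alpha> {\<one>\<^bsub>\<Gamma>\<^esub>} = 0 \<and> (\<forall>g \<in> carrier \<Gamma>. g \<noteq> \<one>\<^bsub>\<Gamma>\<^esub> \<longrightarrow> \<alpha> {g} \<noteq> 0)"

section \<open>The count function and matroids\<close>

text \<open>
  For connected \<open>F\<close> and polymatroidal \<open>\<alpha>\<close> the value does not depend on the chosen vertex, because
  the groups at different vertices are conjugate and \<open>\<alpha>\<close> is invariant under conjugation.
\<close>

definition alpha_tilde ::
  "('g, 'm) monoid_scheme \<Rightarrow> ('v, 'e) pre_digraph \<Rightarrow> ('e \<Rightarrow> 'g) \<Rightarrow> ('g set \<Rightarrow> int) \<Rightarrow> 'e set \<Rightarrow> int"
where
  "alpha_tilde \<Gamma> G \<psi> \<alpha> F = \<alpha> (gain_group \<Gamma> G \<psi> F (SOME v. v \<in> edge_verts G F))"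

definition f_alpha ::
  "('g, 'm) monoid_scheme \<Rightarrow> ('v, 'e) pre_digraph \<Rightarrow> ('e \<Rightarrow> 'g) \<Rightarrow> int \<Rightarrow> int \<Rightarrow>
   ('g set \<Rightarrow> int) \<Rightarrow> 'e set \<Rightarrow> int" where
  "f_alpha \<Gamma> G \<psi> k l \<alpha> F =
     k * int (card (edge_verts G F)) - l +
     (if near_balanced \<Gamma> G \<psi> F then min (alpha_tilde \<Gamma> G \<psi> \<alpha> F) k else alpha_tilde \<Gamma> G \<psi> \<alpha> F)"

definition I_alpha ::
  "('g, 'm) monoid_scheme \<Rightarrow> ('v, 'e) pre_digraph \<Rightarrow> ('e \<Rightarrow> 'g) \<Rightarrow> int \<Rightarrow> int \<Rightarrow>
   ('g set \<Rightarrow> int) \<Rightarrow> 'e set set" where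
  "I_alpha \<Gamma> G \<psi> k l \<alpha> =
     {I. I \<subseteq> arcs G \<and>
         (\<forall>F \<in> connected_edge_sets G \<inter> Pow I. int (card F) \<le> f_alpha \<Gamma> G \<psi> k l \<alpha> F)}"

definition matroid_independent_sets :: "'e set \<Rightarrow> 'e set set \<Rightarrow> bool" where
  "matroid_independent_sets E \<I> \<longleftrightarrow>
     finite E \<and> \<I> \<subseteq> Pow E \<and> {} \<in> \<I> \<and>
     (\<forall>I J. J \<in> \<I> \<longrightarrow> I \<subseteq> J \<longrightarrow> I \<in> \<I>) \<and>
     (\<forall>I J. I \<in> \<I> \<longrightarrow> J \<in> \<I> \<longrightarrow> card I < card J \<longrightarrow> (\<exists>e \<in> J - I. insert e I \<in> \<I>))"

end

theory Submission
  imports Defs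
begin

text \<open>
  Let \<open>f\<close> be the count function, \<open>f F = k |V F| - l + \<beta> F\<close>, and let \<open>I\<close> be independent. Call a
  connected edge set \<open>X\<close> tight if \<open>f X \<le> |I \<inter> X|\<close>. An edge \<open>e\<close> for which \<open>I + e\<close> is dependent lies
  in a tight set. If the union of two tight sets that meet is always tight, then the maximal tight
  sets are disjoint, and since \<open>|J \<inter> X| \<le> f X \<le> |I \<inter> X|\<close> for every independent \<open>J\<close> and every tight
  \<open>X\<close>, adding up over them shows that a larger independent set \<open>J\<close> cannot consist of elements of
  \<open>I\<close> and of edges that are dependent on \<open>I\<close>. So everything rests on the inequality
  \<open>|I \<inter> (X \<inter> Y)| + f (X \<union> Y) \<le> f X + f Y\<close> (theorem \<open>uncrossing\<close>).

  The function \<open>f\<close> is not submodular: capping \<open>\<beta>\<close> at \<open>k\<close> on near-balanced sets destroys this. What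
  saves the inequality is that its first term counts elements of an independent set. If \<open>X \<inter> Y\<close> is
  divided into parts \<open>P\<close> and \<open>Q\<close> that share \<open>s\<close> vertices, then bounding \<open>I \<inter> P\<close> and \<open>I \<inter> Q\<close>
  separately gains a second \<open>l\<close>, which pays for \<open>\<beta> (X \<union> Y) \<le> l\<close>; what remains to be shown is
  \<open>b + b' + k s \<le> \<beta> X + \<beta> Y\<close>, where \<open>b\<close> and \<open>b'\<close> bound \<open>\<beta>\<close> on the connected subsets of \<open>P\<close> and \<open>Q\<close>
  (lemma \<open>uncrosses_by_partition\<close>). So there is nothing to fear when \<open>X \<inter> Y\<close> is disconnected, or
  when \<open>\<beta> X\<close> and \<open>\<beta> Y\<close> are large and \<open>X \<inter> Y\<close> falls apart into balanced sets at one or two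
  vertices.

  Now let \<open>X \<inter> Y\<close> be connected, and let \<open>d\<close> be the number of common vertices of \<open>X\<close> and \<open>Y\<close> that
  are not vertices of \<open>X \<inter> Y\<close>. Each of them contributes \<open>k\<close> to the right-hand side, which suffices
  for \<open>d \<ge> 2\<close>. For \<open>d = 1\<close> the gain group of \<open>X \<union> Y\<close> is generated by those of \<open>X\<close> and \<open>Y\<close> and one
  more element. Smoothness bounds its cost by \<open>k\<close>, unless \<open>X\<close> and \<open>Y\<close> are both balanced; but then
  splitting the extra vertex makes \<open>X \<union> Y\<close> balanced, and the cap applies. For \<open>d = 0\<close> the gain
  group of \<open>X \<union> Y\<close> is generated by those of \<open>X\<close> and \<open>Y\<close>, and the inequality is submodularity of
  \<open>\<alpha>\<close> unless \<open>X\<close> (or, symmetrically, \<open>Y\<close>) is near-balanced with \<open>\<alpha>\<close>-value above \<open>k\<close>. In that case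
  the gain group of \<open>X\<close> is cyclic, with a generator whose square is not the identity by
  smoothness. Either the splits of \<open>X\<close> and \<open>Y\<close> fit together to a split of \<open>X \<union> Y\<close>, or \<open>X \<inter> Y\<close>
  falls apart as above, or \<open>\<beta> X + \<beta> Y = 2 k\<close> exceeds \<open>l\<close> while \<open>X \<inter> Y\<close> is balanced, or the gain
  group of \<open>Y\<close> is so large that \<open>X\<close> adds at most \<open>k\<close> to it (nothing at all if \<open>X \<inter> Y\<close> is
  unbalanced, since then it has the same gain group as \<open>X\<close>).

  These case distinctions never look at cycles. An edge set is balanced iff it has a potential
  (theorem \<open>balanced_iff_potential\<close>). An unbalanced connected set is near-balanced iff it has two
  functions that agree off one vertex \<open>v\<close>, such that each edge respects one of them or is a loop
  at \<open>v\<close> that leads from one to the other (theorem \<open>near_balanced_iff\<close>). Two potentials of the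
  same edge have the same ratio at both ends, so vertex sets on which a ratio has a given value
  are unions of components off the split vertices; this is where the parts \<open>P\<close> and \<open>Q\<close> come from.
\<close>

section \<open>Cancellation in groups\<close>

context group
begin

lemma inv_cancel_left [simp]:
  "x \<in> carrier G \<Longrightarrow> y \<in> carrier G \<Longrightarrow> inv x \<otimes> (x \<otimes> y) = y"
  "x \<in> carrier G \<Longrightarrow> y \<in> carrier G \<Longrightarrow> x \<otimes> (inv x \<otimes> y) = y"
  by (simp_all add: m_assoc[symmetric])

lemma inv_inject [simp]:
  "x \<in> carrier G \<Longrightarrow> y \<in> carrier G \<Longrightarrow> inv x = inv y \<longleftrightarrow> x = y"
  by (metis inv_inv)

lemma solve_right:
  assumes "a \<otimes> x = b" "a \<in> carrier G" "x \<in> carrier G"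
  shows "x = inv a \<otimes> b" and "inv x = inv b \<otimes> a"
  using assms(2-) unfolding assms(1)[symmetric] by (simp_all add: inv_mult_group m_assoc)

end

section \<open>Walk gains and potentials\<close>

locale labeled_graph = group \<Gamma>
  for \<Gamma> :: "('g, 'm) monoid_scheme" (structure) +
  fixes G :: "('v, 'e) pre_digraph" and \<psi> :: "'e \<Rightarrow> 'g"
  assumes finite_edges: "finite (arcs G)"
    and label_closed [simp]: "e \<in> arcs G \<Longrightarrow> \<psi> e \<in> carrier \<Gamma>"
begin

abbreviation V :: "'e set \<Rightarrow> 'v set" where
  "V F \<equiv> edge_verts G F"

abbreviation both_ways :: "'e set \<Rightarrow> ('v, 'e \<times> bool) pre_digraph" where
  "both_ways F \<equiv> two_way (edge_subgraph G F)"

text \<open>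
  Walks enter only through the relation that \<open>x\<close> is the gain of some walk from \<open>u\<close> to \<open>w\<close> in \<open>F\<close>.
\<close>

definition walk_gain :: "'e set \<Rightarrow> 'v \<Rightarrow> 'v \<Rightarrow> 'g \<Rightarrow> bool" where
  "walk_gain F u w x \<longleftrightarrow>
     (\<exists>p. pre_digraph.awalk (both_ways F) u p w \<and> x = gain \<Gamma> \<psi> p)"

definition potential :: "('v \<Rightarrow> 'g) \<Rightarrow> 'e set \<Rightarrow> bool" where
  "potential p F \<longleftrightarrow>
     range p \<subseteq> carrier \<Gamma> \<and> (\<forall>e \<in> F. p (tail G e) \<otimes> \<psi> e = p (head G e))"

text \<open>
  The gain \<open>x\<close> of a walk from \<open>u\<close> to \<open>w\<close> then satisfies \<open>p u \<otimes> x \<otimes> inv (p w) \<in> H\<close>. For the trivial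
  group this is a potential; in general it is the tool for bounding a gain group by \<open>H\<close>.
\<close>

definition potential_modulo :: "'g set \<Rightarrow> ('v \<Rightarrow> 'g) \<Rightarrow> 'e set \<Rightarrow> bool" where
  "potential_modulo H p F \<longleftrightarrow>
     range p \<subseteq> carrier \<Gamma> \<and> (\<forall>e \<in> F. p (tail G e) \<otimes> \<psi> e \<otimes> inv (p (head G e)) \<in> H)"

lemma both_ways_simps [simp]:
  "verts (both_ways F) = V F" "arcs (both_ways F) = F \<times> UNIV"
  "tail (both_ways F) (e, b) = (if b then tail G e else head G e)"
  "head (both_ways F) (e, b) = (if b then head G e else tail G e)"
  by (simp_all add: two_way_def edge_subgraph_def)

lemma endpoints_in_V [simp]:
  "e \<in> F \<Longrightarrow> tail G e \<in> V F" "e \<in> F \<Longrightarrow> head G e \<in> V F"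
  by (simp_all add: edge_verts_def)

lemma V_mono: "F \<subseteq> F' \<Longrightarrow> V F \<subseteq> V F'"
  by (auto simp: edge_verts_def)

lemma V_Un: "V (F \<union> F') = V F \<union> V F'"
  by (auto simp: edge_verts_def)

lemma V_cases:
  assumes "w \<in> V F"
  obtains e where "e \<in> F" "w = tail G e" | e where "e \<in> F" "w = head G e"
  using assms by (auto simp: edge_verts_def)

lemma finite_V: "F \<subseteq> arcs G \<Longrightarrow> finite (V F)"
  using finite_edges finite_subset by (auto simp: edge_verts_def)

lemma wf_both_ways: "wf_digraph (both_ways F)"
  by unfold_locales (auto simp: edge_verts_def)

lemma gain_Nil [simp]: "gain \<Gamma> \<psi> [] = \<one>"
  and gain_Cons [simp]: "gain \<Gamma> \<psi> ((e, b) # p) = (if b then \<psi> e else inv (\<psi> e)) \<otimes> gain \<Gamma> \<psi> p"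
  by (simp_all add: gain_def)

lemma gain_closed [simp]: "set p \<subseteq> arcs G \<times> UNIV \<Longrightarrow> gain \<Gamma> \<psi> p \<in> carrier \<Gamma>"
  by (induction p) (auto simp: gain_def)

lemma gain_append:
  assumes "set p \<subseteq> arcs G \<times> UNIV" "set q \<subseteq> arcs G \<times> UNIV"
  shows "gain \<Gamma> \<psi> (p @ q) = gain \<Gamma> \<psi> p \<otimes> gain \<Gamma> \<psi> q"
  using assms
proof (induction p)
  case (Cons a p)
  then show ?case
    by (cases a) (auto simp: m_assoc)
qed simp

lemma awalk_edges: "pre_digraph.awalk (both_ways F) u p w \<Longrightarrow> set p \<subseteq> F \<times> UNIV"
  by (simp add: pre_digraph.awalk_def)

lemma walk_gain_ends: "walk_gain F u w x \<Longrightarrow> u \<in> V F \<and> w \<in> V F"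
  using wf_digraph.awalkE'[OF wf_both_ways] unfolding walk_gain_def both_ways_simps(1)[symmetric]
  by metis

lemma walk_gain_closed: "F \<subseteq> arcs G \<Longrightarrow> walk_gain F u w x \<Longrightarrow> x \<in> carrier \<Gamma>"
  unfolding walk_gain_def using awalk_edges gain_closed by blast

lemma walk_gain_refl: "v \<in> V F \<Longrightarrow> walk_gain F v v \<one>"
  unfolding walk_gain_def
  by (rule exI[of _ "[]"]) (simp add: wf_digraph.awalk_Nil_iff[OF wf_both_ways])

lemma walk_gain_trans:
  assumes "F \<subseteq> arcs G" "walk_gain F u v x" "walk_gain F v w y"
  shows "walk_gain F u w (x \<otimes> y)"
proof -
  obtain p q where "pre_digraph.awalk (both_ways F) u p v" "x = gain \<Gamma> \<psi> p"
    "pre_digraph.awalk (both_ways F) v q w" "y = gain \<Gamma> \<psi> q"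
    using assms(2,3) unfolding walk_gain_def by blast
  moreover have "set p \<subseteq> arcs G \<times> UNIV" "set q \<subseteq> arcs G \<times> UNIV"
    using calculation(1,3) assms(1) awalk_edges by blast+
  ultimately show ?thesis
    unfolding walk_gain_def using wf_digraph.awalk_appendI[OF wf_both_ways] gain_append by metis
qed

lemma walk_gain_edge:
  assumes "F \<subseteq> arcs G" "e \<in> F"
  shows "walk_gain F (tail G e) (head G e) (\<psi> e)"
    and "walk_gain F (head G e) (tail G e) (inv (\<psi> e))"
  unfolding walk_gain_def
   apply (rule exI[of _ "[(e, True)]"])
  using assms apply (auto simp: wf_digraph.awalk_simps[OF wf_both_ways])[1]
  apply (rule exI[of _ "[(e, False)]"])
  using assms apply (auto simp: wf_digraph.awalk_simps[OF wf_both_ways])[1]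
  done

text \<open>
  Steps are taken at the start of the walk, as in the recursion for \<^const>\<open>gain\<close>.
\<close>

lemma walk_gain_induct [consumes 2, case_names refl fwd bwd]:
  assumes "F \<subseteq> arcs G" "walk_gain F u w x"
    and "\<And>v. v \<in> V F \<Longrightarrow> P v v \<one>"
    and "\<And>e w x. e \<in> F \<Longrightarrow> walk_gain F (head G e) w x \<Longrightarrow> P (head G e) w x \<Longrightarrow> P (tail G e) w (\<psi> e \<otimes> x)"
    and "\<And>e w x. e \<in> F \<Longrightarrow> walk_gain F (tail G e) w x \<Longrightarrow> P (tail G e) w x \<Longrightarrow> P (head G e) w (inv (\<psi> e) \<otimes> x)"
  shows "P u w x"
proof -
  obtain p where "pre_digraph.awalk (both_ways F) u p w" "x = gain \<Gamma> \<psi> p"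
    using assms(2) unfolding walk_gain_def by blast
  then show ?thesis
  proof (induction p arbitrary: u x)
    case Nil
    then show ?case
      using assms(3) by (auto simp: wf_digraph.awalk_Nil_iff[OF wf_both_ways])
  next
    case (Cons a p)
    obtain e b where a: "a = (e, b)"
      by fastforce
    have e: "e \<in> F" "u = (if b then tail G e else head G e)"
      and p: "pre_digraph.awalk (both_ways F) (if b then head G e else tail G e) p w"
      using Cons.prems(1) by (auto simp: a wf_digraph.awalk_Cons_iff[OF wf_both_ways])
    have "walk_gain F (if b then head G e else tail G e) w (gain \<Gamma> \<psi> p)"
      using p unfolding walk_gain_def by blast
    then show ?case
      using Cons.IH[OF p refl] assms(4)[OF e(1)] assms(5)[OF e(1)] e(2) Cons.prems(2)
      by (cases b) (auto simp: a)
  qed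
qed

lemma walk_gain_sym:
  assumes "F \<subseteq> arcs G" "walk_gain F u w x"
  shows "walk_gain F w u (inv x)"
  using assms
proof (induction rule: walk_gain_induct)
  case (refl v)
  then show ?case
    by (simp add: walk_gain_refl)
next
  case (fwd e w x)
  have "walk_gain F w (tail G e) (inv x \<otimes> inv (\<psi> e))"
    using walk_gain_trans[OF assms(1) fwd(3) walk_gain_edge(2)[OF assms(1) fwd(1)]] .
  moreover have "x \<in> carrier \<Gamma>" "\<psi> e \<in> carrier \<Gamma>"
    using fwd assms(1) walk_gain_closed by auto
  ultimately show ?case
    by (simp add: inv_mult_group)
next
  case (bwd e w x)
  have "walk_gain F w (head G e) (inv x \<otimes> \<psi> e)"
    using walk_gain_trans[OF assms(1) bwd(3) walk_gain_edge(1)[OF assms(1) bwd(1)]] .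
  moreover have "x \<in> carrier \<Gamma>" "\<psi> e \<in> carrier \<Gamma>"
    using bwd assms(1) walk_gain_closed by auto
  ultimately show ?case
    by (simp add: inv_mult_group)
qed

lemma walk_gain_mono:
  assumes "F \<subseteq> F'" "F' \<subseteq> arcs G" "walk_gain F u w x"
  shows "walk_gain F' u w x"
proof -
  have "F \<subseteq> arcs G"
    using assms by blast
  then show ?thesis
    using assms(3)
  proof (induction rule: walk_gain_induct)
    case (refl v)
    then show ?case
      using V_mono[OF assms(1)] walk_gain_refl by blast
  next
    case (fwd e w x)
    then show ?case
      using walk_gain_trans[OF assms(2) walk_gain_edge(1)[OF assms(2)]] assms(1) by blast
  next
    case (bwd e w x)
    then show ?case
      using walk_gain_trans[OF assms(2) walk_gain_edge(2)[OF assms(2)]] assms(1) by blast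
  qed
qed

lemma walk_gain_potential_modulo:
  assumes "subgroup H \<Gamma>" "F \<subseteq> arcs G" "potential_modulo H p F" "walk_gain F u w x"
  shows "p u \<otimes> x \<otimes> inv (p w) \<in> H"
  using assms(2,4)
proof (induction rule: walk_gain_induct)
  case (refl v)
  have "p v \<in> carrier \<Gamma>"
    using assms(3) by (auto simp: potential_modulo_def)
  then show ?case
    using subgroup.one_closed[OF assms(1)] by simp
next
  case (fwd e w x)
  have c: "p v \<in> carrier \<Gamma>" for v
    using assms(3) by (auto simp: potential_modulo_def)
  have x: "x \<in> carrier \<Gamma>" "\<psi> e \<in> carrier \<Gamma>"
    using fwd assms(2) walk_gain_closed by auto
  have "(p (tail G e) \<otimes> \<psi> e \<otimes> inv (p (head G e))) \<otimes> (p (head G e) \<otimes> x \<otimes> inv (p w)) \<in> H"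
    using subgroup.m_closed[OF assms(1) _ fwd(3)] assms(3) fwd(1) by (auto simp: potential_modulo_def)
  then show ?case
    using c x by (simp add: m_assoc)
next
  case (bwd e w x)
  have c: "p v \<in> carrier \<Gamma>" for v
    using assms(3) by (auto simp: potential_modulo_def)
  have x: "x \<in> carrier \<Gamma>" "\<psi> e \<in> carrier \<Gamma>"
    using bwd assms(2) walk_gain_closed by auto
  have "inv (p (tail G e) \<otimes> \<psi> e \<otimes> inv (p (head G e))) \<otimes> (p (tail G e) \<otimes> x \<otimes> inv (p w)) \<in> H"
    using subgroup.m_closed[OF assms(1) subgroup.m_inv_closed[OF assms(1)] bwd(3)] assms(3) bwd(1)
    by (auto simp: potential_modulo_def)
  then show ?case
    using c x by (simp add: m_assoc inv_mult_group)
qed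

lemma potential_closed [simp]: "potential p F \<Longrightarrow> p v \<in> carrier \<Gamma>"
  by (auto simp: potential_def)

lemma potential_mono: "potential p F' \<Longrightarrow> F \<subseteq> F' \<Longrightarrow> potential p F"
  by (auto simp: potential_def)

lemma walk_gain_potential:
  assumes "F \<subseteq> arcs G" "potential p F" "walk_gain F u w x"
  shows "p u \<otimes> x = p w"
  using assms(1,3)
proof (induction rule: walk_gain_induct)
  case (refl v)
  then show ?case
    using assms(2) by simp
next
  case (fwd e w x)
  have x: "x \<in> carrier \<Gamma>" "\<psi> e \<in> carrier \<Gamma>" "p (tail G e) \<otimes> \<psi> e = p (head G e)"
    using fwd assms walk_gain_closed by (auto simp: potential_def)
  then show ?case
    using assms(2) fwd(3) by (simp add: m_assoc[symmetric])
next
  case (bwd e w x)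
  have x: "x \<in> carrier \<Gamma>" "\<psi> e \<in> carrier \<Gamma>" "p (head G e) = p (tail G e) \<otimes> \<psi> e"
    using bwd assms walk_gain_closed by (auto simp: potential_def)
  then show ?case
    using assms(2) bwd(3) by (simp add: m_assoc)
qed

lemma potential_translate:
  assumes "F \<subseteq> arcs G" "potential p F" "c \<in> carrier \<Gamma>"
  shows "potential (\<lambda>v. c \<otimes> p v) F"
  using assms unfolding potential_def by (auto simp: m_assoc range_subsetD)

text \<open>
  In the two-way digraph the two directions of an edge are different arcs, but a path that repeats
  no vertex cannot use both: the first use leaves a vertex that the second would visit again.
\<close>

lemma apath_distinct_edges:
  assumes "pre_digraph.apath (both_ways F) u p w"
  shows "distinct (map fst p)"
  using assms
proof (induction p arbitrary: u)
  case (Cons a p)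
  obtain e b where a: "a = (e, b)"
    by fastforce
  let ?D = "both_ways F"
  have p: "pre_digraph.apath ?D (head ?D a) p w"
    and u: "tail ?D a \<notin> set (pre_digraph.awalk_verts ?D (head ?D a) p)"
    using Cons.prems by (auto simp: wf_digraph.apath_Cons_iff[OF wf_both_ways])
  have "a' \<in> set p \<Longrightarrow> fst a' \<noteq> e" for a'
  proof
    assume a': "a' \<in> set p" "fst a' = e"
    have "tail ?D a' \<in> set (pre_digraph.awalk_verts ?D (head ?D a) p)"
      "head ?D a' \<in> set (pre_digraph.awalk_verts ?D (head ?D a) p)"
      using a'(1) p wf_digraph.awalk_verts_arc1[OF wf_both_ways]
        wf_digraph.awalk_verts_arc2[OF wf_both_ways] unfolding pre_digraph.apath_def by metis+
    then show False
      using u a' a by (cases a') (auto split: if_splits)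
  qed
  then show ?case
    using Cons.IH[OF p] a by force
qed simp

lemma potential_imp_balanced:
  assumes "F \<subseteq> arcs G" "potential p F"
  shows "balanced \<Gamma> G \<psi> F"
  unfolding balanced_def ucycle_def pre_digraph.cycle_def
proof (intro allI impI, elim conjE exE)
  fix q u
  assume q: "pre_digraph.awalk (both_ways F) u q u"
  then have "walk_gain F u u (gain \<Gamma> \<psi> q)"
    by (auto simp: walk_gain_def)
  then show "gain \<Gamma> \<psi> q = \<one>"
    using walk_gain_potential[OF assms, of u u] walk_gain_closed[OF assms(1), of u u]
      potential_closed[OF assms(2), of u] by simp
qed

lemma two_way_awalk_mono:
  assumes "pre_digraph.awalk (both_ways F) u q w" "F \<subseteq> F'"
  shows "pre_digraph.awalk (both_ways F') u q w"
proof -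
  have "pre_digraph.cas (both_ways F') v q w = pre_digraph.cas (both_ways F) v q w" for v
  proof (induction q arbitrary: v)
    case (Cons a q)
    then show ?case
      by (cases a) (simp only: pre_digraph.cas.simps both_ways_simps)
  qed (simp only: pre_digraph.cas.simps)
  then show ?thesis
    using assms V_mono[OF assms(2)] by (auto simp: pre_digraph.awalk_def)
qed

lemma two_way_awalk_verts:
  "pre_digraph.awalk_verts (both_ways F') v q = pre_digraph.awalk_verts (both_ways F) v q"
proof (induction q arbitrary: v)
  case (Cons a q)
  then show ?case
    by (cases a) (simp only: pre_digraph.awalk_verts.simps both_ways_simps)
qed (simp only: pre_digraph.awalk_verts.simps)

lemma balanced_mono:
  assumes "balanced \<Gamma> G \<psi> F'" "F \<subseteq> F'"
  shows "balanced \<Gamma> G \<psi> F"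
  unfolding balanced_def
proof (intro allI impI)
  fix q
  assume "ucycle (edge_subgraph G F) q"
  then have "ucycle (edge_subgraph G F') q"
    using two_way_awalk_mono[OF _ assms(2)] unfolding ucycle_def pre_digraph.cycle_def
    by (subst two_way_awalk_verts[of F' _ _ F]) blast
  then show "gain \<Gamma> \<psi> q = \<one>"
    using assms(1) by (simp add: balanced_def)
qed

text \<open>
  A potential of the other edges extends to one more edge \<open>e\<close>: either the ends of \<open>e\<close> are joined
  by a path, which forms a cycle with \<open>e\<close>, or the potential may be translated on the component of
  one of the ends.
\<close>

lemma potential_insert:
  assumes F: "insert e F \<subseteq> arcs G" "e \<notin> F" and p: "potential p F"
    and bal: "balanced \<Gamma> G \<psi> (insert e F)"
  shows "\<exists>p. potential p (insert e F)"
proof -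
  let ?u = "tail G e" and ?w = "head G e" and ?D = "both_ways (insert e F)"
  have FE: "F \<subseteq> arcs G" and lab [simp]: "\<psi> e \<in> carrier \<Gamma>"
    using F by auto
  have cyc: "gain \<Gamma> \<psi> q = \<one>" if "pre_digraph.awalk ?D v q v"
    "distinct (tl (pre_digraph.awalk_verts ?D v q))" "q \<noteq> []" "distinct (map fst q)" for v q
    using bal that unfolding balanced_def ucycle_def pre_digraph.cycle_def by blast
  consider (loop) "?u = ?w" | (path) x where "walk_gain F ?w ?u x" "?u \<noteq> ?w"
    | (apart) "?u \<noteq> ?w" "\<nexists>x. walk_gain F ?w ?u x"
    by blast
  then show ?thesis
  proof cases
    case loop
    have "gain \<Gamma> \<psi> [(e, True)] = \<one>"
      by (rule cyc[of ?u])
        (auto simp: loop wf_digraph.awalk_simps[OF wf_both_ways] pre_digraph.awalk_verts.simps)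
    then have "potential p (insert e F)"
      using p loop by (auto simp: potential_def)
    then show ?thesis
      by blast
  next
    case path
    then obtain q where "pre_digraph.awalk (both_ways F) ?w q ?u"
      unfolding walk_gain_def by blast
    then obtain q where q: "pre_digraph.apath (both_ways F) ?w q ?u"
      using wf_digraph.apath_awalk_to_apath[OF wf_both_ways] by blast
    then have aw: "pre_digraph.awalk (both_ways F) ?w q ?u"
      and dist: "distinct (pre_digraph.awalk_verts (both_ways F) ?w q)"
      by (auto simp: pre_digraph.apath_def)
    have sub: "set q \<subseteq> F \<times> UNIV"
      using aw awalk_edges by blast
    have aw': "pre_digraph.awalk ?D ?w q ?u"
      using two_way_awalk_mono[OF aw] by blast
    have "gain \<Gamma> \<psi> ((e, True) # q) = \<one>"
    proof (rule cyc[of ?u])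
      show "pre_digraph.awalk ?D ?u ((e, True) # q) ?u"
        using aw' by (auto simp: wf_digraph.awalk_Cons_iff[OF wf_both_ways])
      show "distinct (tl (pre_digraph.awalk_verts ?D ?u ((e, True) # q)))"
        using dist by (simp add: pre_digraph.awalk_verts.simps two_way_awalk_verts[of "insert e F" _ _ F])
      show "distinct (map fst ((e, True) # q))"
        using apath_distinct_edges[OF q] sub F(2) by auto
    qed simp
    then have "\<psi> e = inv (gain \<Gamma> \<psi> q)"
      using sub FE by (intro inv_equality[symmetric]) (auto intro: gain_closed)
    moreover have "p ?u = p ?w \<otimes> gain \<Gamma> \<psi> q"
      using walk_gain_potential[OF FE p, of ?w ?u "gain \<Gamma> \<psi> q"] aw walk_gain_def by metis
    moreover have "gain \<Gamma> \<psi> q \<in> carrier \<Gamma>"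
      using sub FE by (intro gain_closed) auto
    ultimately have "p ?u \<otimes> \<psi> e = p ?w"
      using p by (simp add: m_assoc)
    then have "potential p (insert e F)"
      using p by (auto simp: potential_def)
    then show ?thesis
      by blast
  next
    case apart
    \<comment> \<open>The component of the head is translated by the factor that makes \<open>e\<close> fit.\<close>
    define K where "K = {v. v = ?w \<or> (\<exists>x. walk_gain F ?w v x)}"
    define c where "c = p ?u \<otimes> \<psi> e \<otimes> inv (p ?w)"
    have c: "c \<in> carrier \<Gamma>"
      using p by (simp add: c_def)
    have "b \<in> K" if "a \<in> K" "walk_gain F a b x" for a b x
      using that walk_gain_trans[OF FE, of ?w a _ b x] by (auto simp: K_def)
    then have closed: "tail G f \<in> K \<longleftrightarrow> head G f \<in> K" if "f \<in> F" for f
      using walk_gain_edge[OF FE that] by metis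
    have "c \<otimes> p ?w = p ?u \<otimes> \<psi> e"
      using p by (simp add: c_def m_assoc)
    moreover have "?w \<in> K" "?u \<notin> K"
      using apart by (auto simp: K_def)
    moreover have "(c \<otimes> p (tail G f)) \<otimes> \<psi> f = c \<otimes> p (head G f)" if "f \<in> F" for f
      using potential_translate[OF FE p c] that by (auto simp: potential_def)
    ultimately have "potential (\<lambda>v. if v \<in> K then c \<otimes> p v else p v) (insert e F)"
      using p c closed unfolding potential_def by (auto simp: image_subset_iff)
    then show ?thesis
      by blast
  qed
qed

theorem balanced_iff_potential:
  assumes "F \<subseteq> arcs G"
  shows "balanced \<Gamma> G \<psi> F \<longleftrightarrow> (\<exists>p. potential p F)"
proof
  assume bal: "balanced \<Gamma> G \<psi> F"
  have "finite F"
    using assms finite_edges finite_subset by blast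
  from this bal assms show "\<exists>p. potential p F"
  proof (induction F rule: finite_induct)
    case empty
    have "potential (\<lambda>_. \<one>) {}"
      by (auto simp: potential_def)
    then show ?case
      by blast
  next
    case (insert e F)
    then obtain p where "potential p F"
      using balanced_mono[of "insert e F" F] by auto
    then show ?case
      using potential_insert insert by blast
  qed
qed (use potential_imp_balanced[OF assms] in blast)

section \<open>Gain groups\<close>

lemma gain_group_eq:
  assumes "F \<subseteq> arcs G" "v \<in> V F"
  shows "gain_group \<Gamma> G \<psi> F v = {x. walk_gain F v v x}"
    and subgroup_gain_group: "subgroup (gain_group \<Gamma> G \<psi> F v) \<Gamma>"
proof -
  let ?S = "{x. walk_gain F v v x}"
  have sub: "subgroup ?S \<Gamma>"
    using walk_gain_closed[OF assms(1)] walk_gain_refl[OF assms(2)] walk_gain_sym[OF assms(1)]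
      walk_gain_trans[OF assms(1)]
    by (intro subgroupI) auto
  have "gain_group \<Gamma> G \<psi> F v = generate \<Gamma> ?S"
    unfolding gain_group_def walk_gain_def by (rule arg_cong[where f = "generate \<Gamma>"]) blast
  also have "\<dots> = ?S"
    using generate_subgroup_incl[OF _ sub] generate.incl[of _ ?S \<Gamma>] by blast
  finally show "gain_group \<Gamma> G \<psi> F v = ?S" .
  with sub show "subgroup (gain_group \<Gamma> G \<psi> F v) \<Gamma>"
    by simp
qed

lemma gain_group_mono:
  assumes "F \<subseteq> F'" "F' \<subseteq> arcs G" "v \<in> V F"
  shows "gain_group \<Gamma> G \<psi> F v \<subseteq> gain_group \<Gamma> G \<psi> F' v"
  using assms walk_gain_mono[OF assms(1,2)] V_mono[OF assms(1)]
  by (subst (1 2) gain_group_eq) auto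

text \<open>
  The normalization \<open>p v = \<one>\<close> makes the gain of a closed walk at \<open>v\<close> itself, rather than a
  conjugate, lie in \<open>H\<close>.
\<close>

lemma gain_group_subset:
  assumes "F \<subseteq> arcs G" "v \<in> V F" "subgroup H \<Gamma>" "potential_modulo H p F" "p v = \<one>"
  shows "gain_group \<Gamma> G \<psi> F v \<subseteq> H"
proof
  fix x
  assume "x \<in> gain_group \<Gamma> G \<psi> F v"
  then have "walk_gain F v v x"
    using gain_group_eq[OF assms(1,2)] by simp
  then show "x \<in> H"
    using walk_gain_potential_modulo[OF assms(3,1,4)] walk_gain_closed[OF assms(1)] assms(5)
    by fastforce
qed

text \<open>
  This is what makes \<^const>\<open>alpha_tilde\<close> independent of the base vertex.
\<close>

lemma gain_group_conj:
  assumes F: "F \<subseteq> arcs G" and x: "walk_gain F u v x"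
  shows "gain_group \<Gamma> G \<psi> F u = (x <# gain_group \<Gamma> G \<psi> F v) #> inv x"
proof -
  have ends: "u \<in> V F" "v \<in> V F" and xc: "x \<in> carrier \<Gamma>"
    using walk_gain_ends[OF x] walk_gain_closed[OF F x] by auto
  have fwd: "walk_gain F u u (x \<otimes> y \<otimes> inv x)" if "walk_gain F v v y" for y
    using walk_gain_trans[OF F walk_gain_trans[OF F x that] walk_gain_sym[OF F x]] .
  have "walk_gain F v v (inv x \<otimes> z \<otimes> x)" if "walk_gain F u u z" for z
    using walk_gain_trans[OF F walk_gain_trans[OF F walk_gain_sym[OF F x] that] x] .
  moreover have "z = x \<otimes> (inv x \<otimes> z \<otimes> x) \<otimes> inv x" if "walk_gain F u u z" for z
    using walk_gain_closed[OF F that] xc by (simp add: m_assoc)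
  ultimately have "\<exists>y. walk_gain F v v y \<and> z = x \<otimes> y \<otimes> inv x" if "walk_gain F u u z" for z
    using that by blast
  then show ?thesis
    using fwd gain_group_eq[OF F ends(1)] gain_group_eq[OF F ends(2)]
    by (auto simp: l_coset_def r_coset_def)
qed

section \<open>Connected edge sets\<close>

lemma connected_edge_sets_iff:
  "F \<in> connected_edge_sets G \<longleftrightarrow>
     F \<subseteq> arcs G \<and> F \<noteq> {} \<and> (\<forall>u \<in> V F. \<forall>w \<in> V F. \<exists>x. walk_gain F u w x)"
  (is "_ \<longleftrightarrow> ?R")
proof -
  let ?S = "with_proj (mk_symmetric (edge_subgraph G F))"
  have vs: "verts ?S = V F"
    and ae: "arcs_ends ?S = (\<Union>e\<in>F. {(tail G e, head G e), (head G e, tail G e)})"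
    by (auto simp: mk_symmetric_def edge_subgraph_def arcs_ends_def arc_to_ends_def with_proj_def
        split: prod.splits)
  have "reachable ?S u w \<longleftrightarrow> (\<exists>x. walk_gain F u w x)" if F: "F \<subseteq> arcs G" for u w
  proof
    assume "reachable ?S u w"
    then have "(u, w) \<in> rtrancl_on (V F) (arcs_ends ?S)"
      unfolding reachable_def vs .
    then show "\<exists>x. walk_gain F u w x"
    proof (induction rule: rtrancl_on_induct)
      case base
      then show ?case
        using walk_gain_refl by blast
    next
      case (step y z)
      then obtain x where x: "walk_gain F u y x"
        by blast
      obtain e where "e \<in> F" "y = tail G e \<and> z = head G e \<or> y = head G e \<and> z = tail G e"
        using step(2) ae by auto
      then have "\<exists>x'. walk_gain F y z x'"
        using walk_gain_edge[OF F] by metis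
      then show ?case
        using walk_gain_trans[OF F x] by blast
    qed
  next
    assume "\<exists>x. walk_gain F u w x"
    then obtain x where "walk_gain F u w x" ..
    with F show "reachable ?S u w"
      unfolding reachable_def vs
    proof (induction rule: walk_gain_induct)
      case (refl v)
      then show ?case
        by simp
    next
      case (fwd e w x)
      then show ?case
        by (intro converse_rtrancl_on_into_rtrancl_on[OF _ fwd(3)]) (unfold ae, auto)
    next
      case (bwd e w x)
      then show ?case
        by (intro converse_rtrancl_on_into_rtrancl_on[OF _ bwd(3)]) (unfold ae, auto)
    qed
  qed
  moreover have "V F \<noteq> {}" if "F \<noteq> {}"
    using that by (auto simp: edge_verts_def)
  ultimately show ?thesis
    unfolding connected_edge_sets_def connected_def strongly_connected_def vs mem_Collect_eq
    by blast
qed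

lemma connectedD:
  assumes "F \<in> connected_edge_sets G"
  shows "F \<subseteq> arcs G" "F \<noteq> {}" "\<And>u w. u \<in> V F \<Longrightarrow> w \<in> V F \<Longrightarrow> \<exists>x. walk_gain F u w x"
  using assms by (auto simp: connected_edge_sets_iff)

lemma connected_singleton:
  assumes "e \<in> arcs G"
  shows "{e} \<in> connected_edge_sets G"
proof -
  have "V {e} = {tail G e, head G e}"
    by (auto simp: edge_verts_def)
  moreover have e: "{e} \<subseteq> arcs G" "e \<in> {e}"
    using assms by auto
  ultimately have "\<exists>x. walk_gain {e} u w x" if "u \<in> V {e}" "w \<in> V {e}" for u w
    using that walk_gain_edge[OF e] walk_gain_refl[of _ "{e}"] by fastforce
  then show ?thesis
    using e(1) by (simp add: connected_edge_sets_iff)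
qed

lemma connected_Un:
  assumes X: "X \<in> connected_edge_sets G" and Y: "Y \<in> connected_edge_sets G"
    and v: "v \<in> V X" "v \<in> V Y"
  shows "X \<union> Y \<in> connected_edge_sets G"
proof -
  have XY: "X \<union> Y \<subseteq> arcs G"
    using X Y by (auto dest: connectedD(1))
  have reach: "\<exists>x. walk_gain (X \<union> Y) v w x" if "w \<in> V (X \<union> Y)" for w
  proof (cases "w \<in> V X")
    case True
    then show ?thesis
      using connectedD(3)[OF X v(1)] walk_gain_mono[OF Un_upper1 XY] by meson
  next
    case False
    then show ?thesis
      using that connectedD(3)[OF Y v(2), of w] walk_gain_mono[OF Un_upper2 XY, of v w]
      by (auto simp: V_Un)
  qed
  have "\<exists>x. walk_gain (X \<union> Y) u w x" if uw: "u \<in> V (X \<union> Y)" "w \<in> V (X \<union> Y)" for u w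
  proof -
    obtain x y where x: "walk_gain (X \<union> Y) v u x" and y: "walk_gain (X \<union> Y) v w y"
      using reach[OF uw(1)] reach[OF uw(2)] by blast
    show ?thesis
      using walk_gain_trans[OF XY walk_gain_sym[OF XY x] y] by blast
  qed
  then show ?thesis
    using XY connectedD(2)[OF X] by (simp add: connected_edge_sets_iff)
qed

text \<open>
  The vertices that can be reached from a given one separate the edges.
\<close>

lemma disconnected_split:
  assumes "F \<subseteq> arcs G" "F \<noteq> {}" "F \<notin> connected_edge_sets G"
  obtains P Q where "F = P \<union> Q" "P \<inter> Q = {}" "P \<noteq> {}" "Q \<noteq> {}" "V P \<inter> V Q = {}"
proof -
  obtain u w where uw: "u \<in> V F" "w \<in> V F" "\<nexists>x. walk_gain F u w x"
    using assms by (auto simp: connected_edge_sets_iff)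
  define K where "K = {v. \<exists>x. walk_gain F u v x}"
  have closed: "tail G e \<in> K \<longleftrightarrow> head G e \<in> K" if "e \<in> F" for e
  proof -
    have "b \<in> K" if "a \<in> K" "walk_gain F a b x" for a b x
      using that walk_gain_trans[OF assms(1), of u a _ b x] by (auto simp: K_def)
    then show ?thesis
      using walk_gain_edge[OF assms(1) that] by metis
  qed
  have "u \<in> K" "w \<notin> K"
    using walk_gain_refl[OF uw(1)] uw(3) by (auto simp: K_def)
  show thesis
  proof (rule that[of "{e \<in> F. tail G e \<in> K}" "{e \<in> F. tail G e \<notin> K}"])
    show "{e \<in> F. tail G e \<in> K} \<noteq> {}"
      using uw(1) \<open>u \<in> K\<close> closed by (auto elim!: V_cases)
    show "{e \<in> F. tail G e \<notin> K} \<noteq> {}"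
      using uw(2) \<open>w \<notin> K\<close> closed by (auto elim!: V_cases)
    show "V {e \<in> F. tail G e \<in> K} \<inter> V {e \<in> F. tail G e \<notin> K} = {}"
      using closed by (auto simp: edge_verts_def)
  qed auto
qed

section \<open>Potentials of a split\<close>

text \<open>
  A potential of the split at \<open>v\<close>, read in the original graph: \<open>p1\<close> and \<open>p2\<close> extend the common
  values on the other vertices by the values at the two copies of \<open>v\<close>. An edge attached to the
  first (second) copy respects \<open>p1\<close> (\<open>p2\<close>), and an unbalanced loop at \<open>v\<close> leads from one copy to
  the other, in either direction. Loops elsewhere may take any of the alternatives because the two
  functions agree there.
\<close>

definition split_potential :: "'v \<Rightarrow> ('v \<Rightarrow> 'g) \<Rightarrow> ('v \<Rightarrow> 'g) \<Rightarrow> 'e set \<Rightarrow> bool" where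
  "split_potential v p1 p2 F \<longleftrightarrow>
     range p1 \<subseteq> carrier \<Gamma> \<and> range p2 \<subseteq> carrier \<Gamma> \<and> (\<forall>w. w \<noteq> v \<longrightarrow> p1 w = p2 w) \<and>
     (\<forall>e \<in> F. p1 (tail G e) \<otimes> \<psi> e = p1 (head G e) \<or> p2 (tail G e) \<otimes> \<psi> e = p2 (head G e) \<or>
        tail G e = head G e \<and>
          (p1 (tail G e) \<otimes> \<psi> e = p2 (head G e) \<or> p2 (tail G e) \<otimes> \<psi> e = p1 (head G e)))"

lemma split_potential_if_split_balanced:
  assumes F: "F \<subseteq> arcs G" and E2: "E2 \<subseteq> nonloops_at G v"
    and R: "R \<subseteq> unbalanced_loops_at \<Gamma> G \<psi> v"
    and bal: "balanced \<Gamma> (split_graph G v E2 (unbalanced_loops_at \<Gamma> G \<psi> v))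
                (\<lambda>e. if e \<in> R then inv (\<psi> e) else \<psi> e) F"
  shows "\<exists>p1 p2. split_potential v p1 p2 F"
proof -
  let ?L = "unbalanced_loops_at \<Gamma> G \<psi> v"
  let ?S = "split_graph G v E2 ?L" and ?\<phi> = "\<lambda>e. if e \<in> R then inv (\<psi> e) else \<psi> e"
  interpret S: labeled_graph \<Gamma> ?S ?\<phi>
    by unfold_locales (auto simp: split_graph_def finite_edges)
  have "F \<subseteq> arcs ?S"
    using F by (simp add: split_graph_def)
  then obtain q where q: "S.potential q F"
    using bal S.balanced_iff_potential by blast
  define p1 where "p1 w = (if w = v then q Split1 else q (Kept w))" for w
  define p2 where "p2 w = (if w = v then q Split2 else q (Kept w))" for w
  have qc: "q x \<in> carrier \<Gamma>" for x
    using q by simp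
  have qe: "q (tail ?S e) \<otimes> ?\<phi> e = q (head ?S e)" if "e \<in> F" for e
    using q that by (simp add: S.potential_def)
  have "p1 (tail G e) \<otimes> \<psi> e = p1 (head G e) \<or> p2 (tail G e) \<otimes> \<psi> e = p2 (head G e) \<or>
        tail G e = head G e \<and>
          (p1 (tail G e) \<otimes> \<psi> e = p2 (head G e) \<or> p2 (tail G e) \<otimes> \<psi> e = p1 (head G e))"
    if e: "e \<in> F" for e
  proof (cases "e \<in> R")
    case True
    then have L: "e \<in> ?L"
      using R by blast
    moreover have "e \<notin> nonloops_at G v"
      using L by (auto simp: unbalanced_loops_at_def nonloops_at_def)
    ultimately have *: "tail G e = v" "head G e = v" "e \<in> ?L" "e \<notin> E2" "\<psi> e \<in> carrier \<Gamma>"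
      using E2 by (auto simp: unbalanced_loops_at_def)
    then have "q Split1 \<otimes> inv (\<psi> e) = q Split2"
      using qe[OF e] True by (auto simp: split_graph_def)
    then have "q Split2 \<otimes> \<psi> e = q Split1"
      using * qc by (metis inv_solve_right')
    then show ?thesis
      using * by (simp add: p1_def p2_def)
  next
    case False
    have "e \<in> ?L \<Longrightarrow> tail G e = v \<and> head G e = v"
      by (simp add: unbalanced_loops_at_def)
    moreover have "e \<in> E2 \<Longrightarrow> tail G e \<noteq> head G e"
      using E2 by (auto simp: nonloops_at_def)
    ultimately show ?thesis
      using qe[OF e] False
      by (auto simp: p1_def p2_def split_graph_def split: if_splits)
  qed
  then have "split_potential v p1 p2 F"
    using qc by (auto simp: split_potential_def p1_def p2_def)
  then show ?thesis
    by blast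
qed

text \<open>
  The split sends an edge to the second copy of \<open>v\<close> only if it does not respect \<open>p1\<close>, and reverses
  the loops that lead from the second copy to the first.
\<close>

lemma split_balanced_if_split_potential:
  assumes F: "F \<subseteq> arcs G" and p: "split_potential v p1 p2 F"
  obtains E2 R where "E2 \<subseteq> nonloops_at G v" "R \<subseteq> unbalanced_loops_at \<Gamma> G \<psi> v"
    "balanced \<Gamma> (split_graph G v E2 (unbalanced_loops_at \<Gamma> G \<psi> v))
       (\<lambda>e. if e \<in> R then inv (\<psi> e) else \<psi> e) F"
proof -
  let ?L = "unbalanced_loops_at \<Gamma> G \<psi> v"
  define E2 where "E2 = {e \<in> nonloops_at G v. p1 (tail G e) \<otimes> \<psi> e \<noteq> p1 (head G e)}"
  define R where "R = {e \<in> ?L. p1 v \<otimes> \<psi> e \<noteq> p2 v}"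
  let ?S = "split_graph G v E2 ?L" and ?\<phi> = "\<lambda>e. if e \<in> R then inv (\<psi> e) else \<psi> e"
  interpret S: labeled_graph \<Gamma> ?S ?\<phi>
    by unfold_locales (auto simp: split_graph_def finite_edges)
  define q where "q x = (case x of Kept w \<Rightarrow> p1 w | Split1 \<Rightarrow> p1 v | Split2 \<Rightarrow> p2 v)" for x
  have c: "p1 w \<in> carrier \<Gamma>" "p2 w \<in> carrier \<Gamma>" for w
    using p by (auto simp: split_potential_def)
  have off: "p1 w = p2 w" if "w \<noteq> v" for w
    using p that by (auto simp: split_potential_def)
  have "q (tail ?S e) \<otimes> ?\<phi> e = q (head ?S e)" if e: "e \<in> F" for e
  proof -
    have lab: "\<psi> e \<in> carrier \<Gamma>"
      using F e by auto
    have alt: "p1 (tail G e) \<otimes> \<psi> e = p1 (head G e) \<or> p2 (tail G e) \<otimes> \<psi> e = p2 (head G e) \<or>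
        tail G e = head G e \<and>
          (p1 (tail G e) \<otimes> \<psi> e = p2 (head G e) \<or> p2 (tail G e) \<otimes> \<psi> e = p1 (head G e))"
      using p e by (auto simp: split_potential_def)
    consider (unb) "e \<in> ?L" | (loop) "tail G e = head G e" "e \<notin> ?L" | (nonloop) "tail G e \<noteq> head G e"
      by blast
    then show ?thesis
    proof cases
      case unb
      then have *: "tail G e = v" "head G e = v" "\<psi> e \<noteq> \<one>" "e \<notin> E2"
        by (auto simp: unbalanced_loops_at_def E2_def nonloops_at_def)
      show ?thesis
      proof (cases "e \<in> R")
        case True
        then have "p2 v \<otimes> \<psi> e = p1 v"
          using alt * lab c by (auto simp: R_def)
        then have "p1 v \<otimes> inv (\<psi> e) = p2 v"
          using lab c by (metis inv_solve_right')
        then show ?thesis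
          using True unb * by (simp add: split_graph_def q_def)
      next
        case False
        then show ?thesis
          using unb * by (simp add: R_def split_graph_def q_def)
      qed
    next
      case loop
      then have "e \<notin> R" "e \<notin> E2"
        by (auto simp: R_def E2_def nonloops_at_def)
      moreover have "p1 (tail G e) \<otimes> \<psi> e = p1 (head G e)"
      proof (cases "tail G e = v")
        case True
        then show ?thesis
          using loop F e c lab by (auto simp: unbalanced_loops_at_def)
      next
        case False
        then show ?thesis
          using alt off loop by auto
      qed
      ultimately show ?thesis
        using loop by (auto simp: split_graph_def q_def)
    next
      case nonloop
      then have nl: "e \<notin> ?L" "e \<notin> R"
        by (auto simp: unbalanced_loops_at_def R_def)
      have "e \<in> E2 \<longleftrightarrow> (tail G e = v \<or> head G e = v) \<and> p1 (tail G e) \<otimes> \<psi> e \<noteq> p1 (head G e)"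
        using nonloop F e by (auto simp: E2_def nonloops_at_def)
      then show ?thesis
        using nonloop nl alt off[of "tail G e"] off[of "head G e"]
        by (cases "tail G e = v"; cases "head G e = v") (simp_all add: split_graph_def q_def, metis+)
    qed
  qed
  then have "S.potential q F"
    using c by (auto simp: S.potential_def q_def split: split_vertex.splits)
  then have "balanced \<Gamma> ?S ?\<phi> F"
    using F by (intro S.potential_imp_balanced[of F q]) (auto simp: split_graph_def)
  moreover have "E2 \<subseteq> nonloops_at G v" "R \<subseteq> ?L"
    by (auto simp: E2_def R_def)
  ultimately show thesis
    using that by blast
qed

theorem near_balanced_iff:
  "near_balanced \<Gamma> G \<psi> F \<longleftrightarrow>
     F \<in> connected_edge_sets G \<and> \<not> balanced \<Gamma> G \<psi> F \<and>
     (\<exists>v \<in> verts G. \<exists>p1 p2. split_potential v p1 p2 F)"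
proof
  assume "near_balanced \<Gamma> G \<psi> F"
  then show "F \<in> connected_edge_sets G \<and> \<not> balanced \<Gamma> G \<psi> F \<and>
     (\<exists>v \<in> verts G. \<exists>p1 p2. split_potential v p1 p2 F)"
    using split_potential_if_split_balanced connectedD(1) unfolding near_balanced_def
    by (smt (verit) Un_upper2)
next
  assume *: "F \<in> connected_edge_sets G \<and> \<not> balanced \<Gamma> G \<psi> F \<and>
     (\<exists>v \<in> verts G. \<exists>p1 p2. split_potential v p1 p2 F)"
  then obtain v p1 p2 where v: "v \<in> verts G" "split_potential v p1 p2 F"
    by blast
  obtain E2 R where ER: "E2 \<subseteq> nonloops_at G v" "R \<subseteq> unbalanced_loops_at \<Gamma> G \<psi> v"
    "balanced \<Gamma> (split_graph G v E2 (unbalanced_loops_at \<Gamma> G \<psi> v))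
       (\<lambda>e. if e \<in> R then inv (\<psi> e) else \<psi> e) F"
    using split_balanced_if_split_potential[OF _ v(2)] * connectedD(1) by metis
  have "(nonloops_at G v - E2) \<union> E2 = nonloops_at G v" "(nonloops_at G v - E2) \<inter> E2 = {}"
    using ER(1) by auto
  then show "near_balanced \<Gamma> G \<psi> F"
    unfolding near_balanced_def using * v(1) ER(2,3) by blast
qed

lemma split_potential_closed:
  assumes "split_potential v p1 p2 F"
  shows "p1 w \<in> carrier \<Gamma>" "p2 w \<in> carrier \<Gamma>"
  using assms by (auto simp: split_potential_def)

lemma split_potential_off:
  "split_potential v p1 p2 F \<Longrightarrow> w \<noteq> v \<Longrightarrow> p2 w = p1 w"
  by (auto simp: split_potential_def)

lemma split_potential_mono:
  "split_potential v p1 p2 F' \<Longrightarrow> F \<subseteq> F' \<Longrightarrow> split_potential v p1 p2 F"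
  unfolding split_potential_def by blast

lemma split_potential_swap:
  "split_potential v p1 p2 F \<Longrightarrow> split_potential v p2 p1 F"
  unfolding split_potential_def by metis

lemma split_potential_nonloop:
  assumes "split_potential v p1 p2 F" "e \<in> F" "tail G e \<noteq> head G e \<or> tail G e \<noteq> v"
  shows "p1 (tail G e) \<otimes> \<psi> e = p1 (head G e) \<or> p2 (tail G e) \<otimes> \<psi> e = p2 (head G e)"
  using assms unfolding split_potential_def by metis

lemma split_potential_off_edge:
  assumes "split_potential v p1 p2 F" "e \<in> F" "tail G e \<noteq> v" "head G e \<noteq> v"
  shows "p1 (tail G e) \<otimes> \<psi> e = p1 (head G e)"
  using split_potential_nonloop[OF assms(1,2)] split_potential_off[OF assms(1)] assms(3,4) by metis

lemma potential_imp_split_potential: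
  assumes "potential p F" "x \<in> carrier \<Gamma>"
  shows "split_potential v p (p(v := x)) F"
  using assms unfolding potential_def split_potential_def by auto

lemma split_potential_translate:
  assumes F: "F \<subseteq> arcs G" and p: "split_potential v p1 p2 F" and c: "c \<in> carrier \<Gamma>"
  shows "split_potential v (\<lambda>w. c \<otimes> p1 w) (\<lambda>w. c \<otimes> p2 w) F"
proof -
  have "c \<otimes> a \<otimes> \<psi> e = c \<otimes> b \<longleftrightarrow> a \<otimes> \<psi> e = b"
    if "e \<in> F" "a \<in> carrier \<Gamma>" "b \<in> carrier \<Gamma>" for a b e
    using that F c by (auto simp: m_assoc)
  then show ?thesis
    using p c split_potential_closed[OF p] unfolding split_potential_def by (auto simp: image_subset_iff)
qed

section \<open>Gluing potentials\<close>

lemma potential_unique: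
  assumes F: "F \<in> connected_edge_sets G" and "potential p F" "potential q F"
    and "v \<in> V F" "p v = q v" "w \<in> V F"
  shows "p w = q w"
proof -
  obtain x where "walk_gain F v w x"
    using connectedD(3)[OF F] assms by blast
  then show ?thesis
    using walk_gain_potential[OF connectedD(1)[OF F]] assms by metis
qed

lemma potential_align:
  assumes F: "F \<in> connected_edge_sets G" and p: "potential p F" and q: "potential q F"
  obtains c where "c \<in> carrier \<Gamma>" "\<And>w. w \<in> V F \<Longrightarrow> c \<otimes> q w = p w"
proof -
  obtain v where v: "v \<in> V F"
    using connectedD(2)[OF F] by (auto simp: edge_verts_def)
  define c where "c = p v \<otimes> inv (q v)"
  have c: "c \<in> carrier \<Gamma>" "c \<otimes> q v = p v"
    using p q by (auto simp: c_def m_assoc)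
  have "c \<otimes> q w = p w" if "w \<in> V F" for w
    using potential_unique[OF F potential_translate[OF connectedD(1)[OF F] q c(1)] p v c(2) that] .
  then show thesis
    using that c by blast
qed

lemma split_potential_glue:
  assumes "split_potential v p1 p2 X" "split_potential v q1 q2 Y"
    and "\<And>w. w \<in> V X \<Longrightarrow> w \<in> V Y \<Longrightarrow> p1 w = q1 w \<and> p2 w = q2 w"
  shows "\<exists>r1 r2. split_potential v r1 r2 (X \<union> Y)"
proof -
  let ?r1 = "\<lambda>w. if w \<in> V X then p1 w else q1 w" and ?r2 = "\<lambda>w. if w \<in> V X then p2 w else q2 w"
  have "?r1 w = q1 w" "?r2 w = q2 w" if "w \<in> V Y" for w
    using assms(3) that by auto
  moreover have "?r1 w = p1 w" "?r2 w = p2 w" if "w \<in> V X" for w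
    using that by auto
  ultimately have "split_potential v ?r1 ?r2 X" "split_potential v ?r1 ?r2 Y"
    using assms(1,2) unfolding split_potential_def by (auto simp: image_subset_iff)
  then have "split_potential v ?r1 ?r2 (X \<union> Y)"
    unfolding split_potential_def by blast
  then show ?thesis
    by blast
qed

text \<open>
  Two potentials that agree on \<open>X \<inter> Y\<close> may disagree at the extra common vertex \<open>u\<close>. Splitting \<open>u\<close>
  into an \<open>X\<close>-copy and a \<open>Y\<close>-copy removes the conflict.
\<close>

lemma balanced_glue_extra_vertex:
  assumes F: "X \<inter> Y \<in> connected_edge_sets G" and Y: "Y \<subseteq> arcs G"
    and p: "potential p X" and q: "potential q Y"
    and V: "V X \<inter> V Y = insert u (V (X \<inter> Y))"
  shows "\<exists>r1 r2. split_potential u r1 r2 (X \<union> Y)"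
proof -
  obtain c where c: "c \<in> carrier \<Gamma>" "\<And>w. w \<in> V (X \<inter> Y) \<Longrightarrow> c \<otimes> q w = p w"
    using potential_align[OF F potential_mono[OF p Int_lower1] potential_mono[OF q Int_lower2]]
    by blast
  let ?q = "\<lambda>w. c \<otimes> q w"
  have q': "potential ?q Y"
    using potential_translate[OF Y q c(1)] .
  have "split_potential u p (p(u := ?q u)) X"
    using potential_imp_split_potential[OF p potential_closed[OF q']] .
  moreover have "split_potential u (?q(u := p u)) ?q Y"
    using split_potential_swap[OF potential_imp_split_potential[OF q' potential_closed[OF p]]] .
  moreover have "p w = (?q(u := p u)) w \<and> (p(u := ?q u)) w = ?q w" if "w \<in> V X" "w \<in> V Y" for w
  proof -
    have "w = u \<or> w \<in> V (X \<inter> Y)"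
      using that V by blast
    then show ?thesis
      using c(2)[of w] by auto
  qed
  ultimately show ?thesis
    by (rule split_potential_glue)
qed

text \<open>
  If \<open>X \<inter> Y\<close> respects \<open>p1\<close>, then all of \<open>Y\<close> can be attached to the first copy of \<open>v\<close>.
\<close>

lemma split_potential_glue_balanced:
  assumes F: "X \<inter> Y \<in> connected_edge_sets G" and Y: "Y \<subseteq> arcs G"
    and p: "split_potential v p1 p2 X" and pF: "potential p1 (X \<inter> Y)" and q: "potential q Y"
    and V: "V X \<inter> V Y = V (X \<inter> Y)"
  shows "\<exists>r1 r2. split_potential v r1 r2 (X \<union> Y)"
proof -
  obtain c where c: "c \<in> carrier \<Gamma>" "\<And>w. w \<in> V (X \<inter> Y) \<Longrightarrow> c \<otimes> q w = p1 w"
    using potential_align[OF F pF potential_mono[OF q Int_lower2]] by blast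
  let ?q = "\<lambda>w. c \<otimes> q w"
  have q': "split_potential v ?q (?q(v := p2 v)) Y"
    using potential_imp_split_potential[OF potential_translate[OF Y q c(1)]]
      split_potential_closed[OF p] by blast
  have "p1 w = ?q w \<and> p2 w = (?q(v := p2 v)) w" if "w \<in> V X" "w \<in> V Y" for w
  proof -
    have "w \<in> V (X \<inter> Y)"
      using that V by blast
    then show ?thesis
      using c(2)[of w] split_potential_off[OF p, of w] by auto
  qed
  then show ?thesis
    using split_potential_glue[OF p q'] by blast
qed

text \<open>
  This invariance turns a comparison of two potentials into a statement about components: the
  ratio \<open>q w \<otimes> inv (p w)\<close> is the same at both ends of every edge that respects both \<open>p\<close> and \<open>q\<close>.
\<close>

lemma ratio_eq:
  assumes "a \<otimes> x = b" "a' \<otimes> x = b'"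
    and "a \<in> carrier \<Gamma>" "a' \<in> carrier \<Gamma>" "x \<in> carrier \<Gamma>"
  shows "a' \<otimes> inv a = b' \<otimes> inv b"
  using assms(3-) unfolding assms(1,2)[symmetric] by (simp add: m_assoc inv_mult_group)

text \<open>
  Let \<open>q\<close> be a potential of \<open>Y\<close> and compare it with \<open>p1\<close> on \<open>X \<inter> Y\<close>. Off \<open>v\<close> the ratio is constant
  on components, and an edge from \<open>v\<close> to a vertex \<open>x\<close> shows whether it respects \<open>p1\<close> or \<open>p2\<close> by
  the ratio at \<open>x\<close>. If both kinds occur, they form the two sides of the cut vertex \<open>v\<close>. If only
  one kind occurs, \<open>Y\<close> can be attached to the corresponding copy of \<open>v\<close>.
\<close>

lemma split_or_cut_vertex_if_balanced:
  assumes F: "X \<inter> Y \<in> connected_edge_sets G" and Y: "Y \<subseteq> arcs G"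
    and p: "split_potential v p1 p2 X" and ne: "p1 v \<noteq> p2 v" and q: "potential q Y"
    and V: "V X \<inter> V Y = V (X \<inter> Y)"
  shows "(\<exists>r1 r2. split_potential v r1 r2 (X \<union> Y)) \<or>
    (\<exists>P Q. X \<inter> Y = P \<union> Q \<and> P \<inter> Q = {} \<and> P \<noteq> {} \<and> Q \<noteq> {} \<and> V P \<inter> V Q \<subseteq> {v})"
proof -
  let ?F = "X \<inter> Y"
  let ?r = "\<lambda>x. q x \<otimes> inv (p1 x)" and ?c1 = "q v \<otimes> inv (p1 v)" and ?c2 = "q v \<otimes> inv (p2 v)"
  have c: "p1 w \<in> carrier \<Gamma>" "p2 w \<in> carrier \<Gamma>" "q w \<in> carrier \<Gamma>" for w
    using split_potential_closed[OF p] q by auto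
  have off: "p2 w = p1 w" if "w \<noteq> v" for w
    using split_potential_off[OF p that] .
  have c12: "?c1 \<noteq> ?c2"
    using ne c by simp
  have lab: "\<psi> e \<in> carrier \<Gamma>" if "e \<in> ?F" for e
    using that Y by auto
  have qe: "q (tail G e) \<otimes> \<psi> e = q (head G e)" if "e \<in> ?F" for e
    using that q by (auto simp: potential_def)
  have ratio1: "?r (tail G e) = ?r (head G e)"
    if "e \<in> ?F" "p1 (tail G e) \<otimes> \<psi> e = p1 (head G e)" for e
    using that qe lab c by (intro ratio_eq[where x = "\<psi> e"]) auto
  have ratio2: "q (tail G e) \<otimes> inv (p2 (tail G e)) = q (head G e) \<otimes> inv (p2 (head G e))"
    if "e \<in> ?F" "p2 (tail G e) \<otimes> \<psi> e = p2 (head G e)" for e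
    using that qe lab c by (intro ratio_eq[where x = "\<psi> e"]) auto
  have off_edge: "p1 (tail G e) \<otimes> \<psi> e = p1 (head G e)"
    if "e \<in> ?F" "tail G e \<noteq> v" "head G e \<noteq> v" for e
    using split_potential_off_edge[OF p] that by blast
  have types: "p1 (tail G e) \<otimes> \<psi> e = p1 (head G e) \<or> p2 (tail G e) \<otimes> \<psi> e = p2 (head G e)"
    if "e \<in> ?F" "tail G e \<noteq> head G e" for e
    using split_potential_nonloop[OF p] that by blast
  have loop: "\<psi> e = \<one>" if "e \<in> ?F" "tail G e = head G e" for e
    using qe[OF that(1)] that lab[OF that(1)] c by simp
  \<comment> \<open>The vertices of the components that are attached to the first copy of \<open>v\<close>.\<close>
  define T where "T = {x. x \<noteq> v \<and> ?r x = ?c1}"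
  define P where "P = {e \<in> ?F. tail G e \<in> T \<or> head G e \<in> T}"
  define Q where "Q = ?F - P"
  have T_closed: "tail G e \<in> T \<longleftrightarrow> head G e \<in> T"
    if "e \<in> ?F" "tail G e \<noteq> v" "head G e \<noteq> v" for e
    using ratio1[OF that(1) off_edge[OF that]] that by (simp add: T_def)
  have share: "V P \<inter> V Q \<subseteq> {v}"
  proof
    fix x
    assume "x \<in> V P \<inter> V Q"
    then obtain e f where e: "e \<in> P" "x = tail G e \<or> x = head G e"
      and f: "f \<in> Q" "x = tail G f \<or> x = head G f"
      by (auto elim!: V_cases)
    have "x \<notin> T"
      using f by (auto simp: P_def Q_def)
    moreover have "v \<notin> T"
      by (simp add: T_def)
    ultimately show "x \<in> {v}"
      using e T_closed[of e] by (auto simp: P_def)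
  qed
  have end1: "p1 (tail G e) \<otimes> \<psi> e = p1 (head G e)" if "e \<in> P" for e
  proof (cases "tail G e = v \<or> head G e = v")
    case True
    have e: "e \<in> ?F" and ends: "tail G e \<noteq> head G e"
      using that True by (auto simp: P_def T_def)
    show ?thesis
    proof (rule ccontr)
      assume "\<not> ?thesis"
      then have "p2 (tail G e) \<otimes> \<psi> e = p2 (head G e)"
        using types[OF e ends] by blast
      then have "q (tail G e) \<otimes> inv (p2 (tail G e)) = q (head G e) \<otimes> inv (p2 (head G e))"
        using ratio2 e by blast
      then show False
        using True ends that off[of "tail G e"] off[of "head G e"] c12 by (auto simp: P_def T_def)
    qed
  next
    case False
    then show ?thesis
      using off_edge that by (auto simp: P_def)
  qed
  have end2: "p2 (tail G e) \<otimes> \<psi> e = p2 (head G e)" if "e \<in> Q" for e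
  proof -
    have e: "e \<in> ?F" "tail G e \<notin> T" "head G e \<notin> T"
      using that by (auto simp: P_def Q_def)
    consider "tail G e = head G e" | "tail G e \<noteq> v" "head G e \<noteq> v"
      | "tail G e \<noteq> head G e" "tail G e = v \<or> head G e = v"
      by blast
    then show ?thesis
    proof cases
      case 1
      then show ?thesis
        using loop[OF e(1)] c by simp
    next
      case 2
      then show ?thesis
        using off_edge[OF e(1)] off by simp
    next
      case 3
      then have "?r (tail G e) \<noteq> ?r (head G e)"
        using e by (auto simp: T_def)
      then show ?thesis
        using ratio1[OF e(1)] types[OF e(1) 3(1)] by blast
    qed
  qed
  show ?thesis
  proof (cases "P = {} \<or> Q = {}")
    case True
    then have "potential p1 ?F \<or> potential p2 ?F"
      using end1 end2 c unfolding potential_def Q_def by blast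
    then show ?thesis
      using split_potential_glue_balanced[OF F Y p _ q V] split_potential_glue_balanced[OF F Y split_potential_swap[OF p] _ q V]
      by blast
  next
    case False
    moreover have "?F = P \<union> Q" "P \<inter> Q = {}"
      by (auto simp: P_def Q_def)
    ultimately show ?thesis
      using share by blast
  qed
qed

section \<open>Gain groups of near-balanced sets and of unions\<close>

text \<open>
  Suppose that \<open>inv (p1 v) \<otimes> p2 v\<close> is not the gain of a closed walk at \<open>v\<close>. Then no vertex can be
  reached from both copies of \<open>v\<close>, so translating \<open>p1\<close> on the vertices reached from the second
  copy merges the two copies into one and gives a potential of \<open>F\<close>.
\<close>

lemma unbalanced_subset_generator:
  assumes F: "F \<in> connected_edge_sets G" and p: "split_potential v p1 p2 F"
    and unb: "\<not> balanced \<Gamma> G \<psi> F"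
  shows "v \<in> V F" and "inv (p1 v) \<otimes> p2 v \<in> gain_group \<Gamma> G \<psi> F v"
proof -
  note FE = connectedD(1)[OF F]
  have c: "p1 w \<in> carrier \<Gamma>" "p2 w \<in> carrier \<Gamma>" for w
    using split_potential_closed[OF p] by auto
  have off: "p2 w = p1 w" if "w \<noteq> v" for w
    using split_potential_off[OF p that] .
  have off_edge: "p1 (tail G e) \<otimes> \<psi> e = p1 (head G e)"
    if "e \<in> F" "tail G e \<noteq> v" "head G e \<noteq> v" for e
    using split_potential_off_edge[OF p that] .
  have nopot: "\<not> potential q F" for q
    using unb potential_imp_balanced[OF FE] by blast
  show v: "v \<in> V F"
  proof (rule ccontr)
    assume "v \<notin> V F"
    then have "tail G e \<noteq> v" "head G e \<noteq> v" if "e \<in> F" for e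
      using that endpoints_in_V by metis+
    then have "potential p1 F"
      using off_edge c by (auto simp: potential_def)
    with nopot show False
      by blast
  qed
  show "inv (p1 v) \<otimes> p2 v \<in> gain_group \<Gamma> G \<psi> F v"
  proof (rule ccontr)
    assume notin: "inv (p1 v) \<otimes> p2 v \<notin> gain_group \<Gamma> G \<psi> F v"
    then have nowalk: "\<not> walk_gain F v v (inv (p1 v) \<otimes> p2 v)"
      using gain_group_eq[OF FE v] by simp
    \<comment> \<open>The vertices that are reached from the second copy of \<open>v\<close>, expressed by a gain in \<open>F\<close>.\<close>
    define S where "S = {w. w \<noteq> v \<and> walk_gain F v w (inv (p2 v) \<otimes> p1 w)}"
    define r where "r w = (if w \<in> S then p1 v \<otimes> inv (p2 v) \<otimes> p1 w else p1 w)" for w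
    have vS: "v \<notin> S" "r v = p1 v"
      by (auto simp: S_def r_def)
    have notS: "w \<notin> S" if "walk_gain F v w (inv (p1 v) \<otimes> p1 w)" for w
    proof
      assume "w \<in> S"
      then have "walk_gain F v w (inv (p2 v) \<otimes> p1 w)"
        by (simp add: S_def)
      from walk_gain_trans[OF FE that walk_gain_sym[OF FE this]] nowalk c show False
        by (simp add: m_assoc inv_mult_group)
    qed
    have "r (tail G e) \<otimes> \<psi> e = r (head G e)" if e: "e \<in> F" for e
    proof -
      have lab: "\<psi> e \<in> carrier \<Gamma>"
        using e FE by auto
      note step = walk_gain_edge[OF FE e]
      consider (off) "tail G e \<noteq> v" "head G e \<noteq> v" | (loop) "tail G e = v" "head G e = v"
        | (out) "tail G e = v" "head G e \<noteq> v" | ("in") "tail G e \<noteq> v" "head G e = v"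
        by blast
      then show ?thesis
      proof cases
        case off
        note eq = off_edge[OF e off]
        have "tail G e \<in> S \<longleftrightarrow> head G e \<in> S"
        proof
          assume "tail G e \<in> S"
          then have "walk_gain F v (head G e) (inv (p2 v) \<otimes> p1 (tail G e) \<otimes> \<psi> e)"
            using walk_gain_trans[OF FE _ step(1)] by (simp add: S_def)
          then show "head G e \<in> S"
            using eq off c lab by (simp add: S_def m_assoc)
        next
          assume "head G e \<in> S"
          then have "walk_gain F v (tail G e) (inv (p2 v) \<otimes> p1 (head G e) \<otimes> inv (\<psi> e))"
            using walk_gain_trans[OF FE _ step(2)] by (simp add: S_def)
          then show "tail G e \<in> S"
            using eq[symmetric] off c lab by (simp add: S_def m_assoc)
        qed
        then show ?thesis
          using eq c lab by (auto simp: r_def m_assoc)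
      next
        case loop
        have "p1 v \<otimes> \<psi> e \<noteq> p2 v"
          using solve_right(1)[of "p1 v" "\<psi> e" "p2 v"] c lab step(1) loop nowalk by auto
        moreover have "p2 v \<otimes> \<psi> e \<noteq> p1 v"
          using solve_right(2)[of "p2 v" "\<psi> e" "p1 v"] c lab step(2) loop nowalk by auto
        ultimately have "p1 v \<otimes> \<psi> e = p1 v \<or> p2 v \<otimes> \<psi> e = p2 v"
          using p e loop unfolding split_potential_def by metis
        then show ?thesis
          using loop vS c lab by auto
      next
        case out
        then consider "p1 v \<otimes> \<psi> e = p1 (head G e)" | "p2 v \<otimes> \<psi> e = p1 (head G e)"
          using split_potential_nonloop[OF p e] off by auto
        then show ?thesis
        proof cases
          case 1
          then have "head G e \<notin> S"
            using notS solve_right(1)[OF 1 c(1) lab] step(1) out by simp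
          then show ?thesis
            using 1 out vS by (simp add: r_def)
        next
          case 2
          then have "head G e \<in> S"
            using solve_right(1)[OF 2 c(2) lab] step(1) out by (simp add: S_def)
          then show ?thesis
            using 2[symmetric] out vS c lab by (simp add: r_def m_assoc)
        qed
      next
        case "in"
        then consider "p1 (tail G e) \<otimes> \<psi> e = p1 v" | "p1 (tail G e) \<otimes> \<psi> e = p2 v"
          using split_potential_nonloop[OF p e] off by auto
        then show ?thesis
        proof cases
          case 1
          then have "tail G e \<notin> S"
            using notS solve_right(2)[OF 1 c(1) lab] step(2) "in" by simp
          then show ?thesis
            using 1 "in" vS by (simp add: r_def)
        next
          case 2
          then have "tail G e \<in> S"
            using solve_right(2)[OF 2 c(1) lab] step(2) "in" by (simp add: S_def)
          then show ?thesis
            using 2 "in" vS c lab by (simp add: r_def m_assoc)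
        qed
      qed
    qed
    then have "potential r F"
      using c by (auto simp: potential_def r_def)
    with nopot show False
      by blast
  qed
qed

text \<open>
  A walk in a set that is balanced after splitting \<open>v\<close> changes its gain only by passing from one
  copy of \<open>v\<close> to the other. The element shown generates the gains at an arbitrary base vertex \<open>b\<close>;
  for \<open>b = v\<close> it is \<open>inv (p1 v) \<otimes> p2 v\<close>.
\<close>

lemma gain_group_split:
  assumes X: "X \<subseteq> arcs G" and p: "split_potential v p1 p2 X" and b: "b \<in> V X"
  shows "gain_group \<Gamma> G \<psi> X b \<subseteq> generate \<Gamma> {inv (p1 b) \<otimes> p2 v \<otimes> inv (p1 v) \<otimes> p1 b}"
proof -
  let ?g = "inv (p1 b) \<otimes> p2 v \<otimes> inv (p1 v) \<otimes> p1 b" and ?p = "\<lambda>w. inv (p1 b) \<otimes> p1 w"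
  have c: "p1 w \<in> carrier \<Gamma>" "p2 w \<in> carrier \<Gamma>" for w
    using split_potential_closed[OF p] by auto
  have g: "?g \<in> carrier \<Gamma>"
    using c by simp
  have sub: "subgroup (generate \<Gamma> {?g}) \<Gamma>"
    using g by (intro generate_is_subgroup) auto
  have gen: "?g \<in> generate \<Gamma> {?g}" "inv ?g \<in> generate \<Gamma> {?g}" "\<one> \<in> generate \<Gamma> {?g}"
    by (auto intro: generate.intros)
  have "?p (tail G e) \<otimes> \<psi> e \<otimes> inv (?p (head G e)) \<in> {\<one>, ?g, inv ?g}" if e: "e \<in> X" for e
  proof -
    have lab: "\<psi> e \<in> carrier \<Gamma>"
      using e X by auto
    have dev: "?p (tail G e) \<otimes> \<psi> e \<otimes> inv (?p (head G e)) =
        inv (p1 b) \<otimes> (p1 (tail G e) \<otimes> \<psi> e) \<otimes> inv (p1 (head G e)) \<otimes> p1 b"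
      using c lab by (simp add: m_assoc inv_mult_group)
    have off: "p2 w = p1 w" if "w \<noteq> v" for w
      using split_potential_off[OF p that] .
    have tail2: "p1 v \<otimes> \<psi> e = p1 v \<otimes> inv (p2 v) \<otimes> x" if "p2 v \<otimes> \<psi> e = x" for x
      using that[symmetric] c lab by (simp add: m_assoc)
    consider (1) "p1 (tail G e) \<otimes> \<psi> e = p1 (head G e)"
      | (2) "tail G e = v" "p2 v \<otimes> \<psi> e = p1 (head G e)"
      | (3) "head G e = v" "p1 (tail G e) \<otimes> \<psi> e = p2 v"
      | (4) "head G e = v" "tail G e = v" "p2 v \<otimes> \<psi> e = p2 v"
      using p e off unfolding split_potential_def by metis
    then show ?thesis
    proof cases
      case 1
      then show ?thesis
        unfolding dev unfolding 1 using c by (simp add: m_assoc)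
    next
      case 2
      then show ?thesis
        unfolding dev using tail2[OF 2(2)] c by (simp add: m_assoc inv_mult_group)
    next
      case 3
      then show ?thesis
        unfolding dev unfolding 3 using c by (simp add: m_assoc)
    next
      case 4
      then have "\<psi> e = \<one>"
        using c lab by simp
      then show ?thesis
        unfolding dev using 4 c by (simp add: m_assoc)
    qed
  qed
  moreover have "{\<one>, ?g, inv ?g} \<subseteq> generate \<Gamma> {?g}"
    using gen by blast
  ultimately have "potential_modulo (generate \<Gamma> {?g}) ?p X"
    using c unfolding potential_modulo_def by (blast intro: m_closed inv_closed)
  then show ?thesis
    using gain_group_subset[OF X b sub] c by simp
qed

text \<open>
  Walk gains from a base vertex form a potential modulo the gain group.
\<close>

lemma base_walks:
  assumes X: "X \<in> connected_edge_sets G" and "v \<in> V X"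
    and "walk_gain X v (tail G e) x" "walk_gain X v (head G e) y" "e \<in> X"
  shows "x \<otimes> \<psi> e \<otimes> inv y \<in> gain_group \<Gamma> G \<psi> X v"
proof -
  note XE = connectedD(1)[OF X]
  show ?thesis
    using walk_gain_trans[OF XE walk_gain_trans[OF XE assms(3) walk_gain_edge(1)[OF XE assms(5)]]
        walk_gain_sym[OF XE assms(4)]] gain_group_eq[OF XE assms(2)] by simp
qed

text \<open>
  A walk in \<open>X \<union> Y\<close> changes between the two sets at common vertices only. So \<open>H\<close> contains all
  gains as soon as, at each common vertex, some walk in \<open>X\<close> and some walk in \<open>Y\<close> from the base
  vertex agree modulo \<open>H\<close>: following \<open>X\<close> where possible and \<open>Y\<close> elsewhere gives a potential modulo
  \<open>H\<close>.
\<close>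

lemma gain_group_Un:
  assumes X: "X \<in> connected_edge_sets G" and Y: "Y \<in> connected_edge_sets G"
    and v: "v \<in> V X" "v \<in> V Y" and H: "subgroup H \<Gamma>"
    and sub: "gain_group \<Gamma> G \<psi> X v \<subseteq> H" "gain_group \<Gamma> G \<psi> Y v \<subseteq> H"
    and meet: "\<And>w. w \<in> V X \<Longrightarrow> w \<in> V Y \<Longrightarrow>
      \<exists>x y. walk_gain X v w x \<and> walk_gain Y v w y \<and> x \<otimes> inv y \<in> H"
  shows "gain_group \<Gamma> G \<psi> (X \<union> Y) v \<subseteq> H"
proof -
  note XE = connectedD(1)[OF X] and YE = connectedD(1)[OF Y]
  have "\<exists>x y. x \<in> carrier \<Gamma> \<and> y \<in> carrier \<Gamma> \<and> (w \<in> V X \<longrightarrow> walk_gain X v w x) \<and>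
      (w \<in> V Y \<longrightarrow> walk_gain Y v w y) \<and> (w \<in> V X \<and> w \<in> V Y \<longrightarrow> x \<otimes> inv y \<in> H) \<and> (w = v \<longrightarrow> x = \<one>)"
    (is "\<exists>x y. ?Q w x y") for w
  proof -
    consider "w = v" | "w \<noteq> v" "w \<in> V X" "w \<in> V Y" | "w \<noteq> v" "w \<in> V X" "w \<notin> V Y"
      | "w \<noteq> v" "w \<notin> V X" "w \<in> V Y" | "w \<noteq> v" "w \<notin> V X" "w \<notin> V Y"
      by blast
    then show ?thesis
    proof cases
      case 1
      then have "?Q w \<one> \<one>"
        using walk_gain_refl[OF v(1)] walk_gain_refl[OF v(2)] subgroup.one_closed[OF H] by simp
      then show ?thesis
        by blast
    next
      case 2
      then obtain x y where xy: "walk_gain X v w x" "walk_gain Y v w y" "x \<otimes> inv y \<in> H"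
        using meet by blast
      then have "?Q w x y"
        using 2 walk_gain_closed[OF XE] walk_gain_closed[OF YE] by simp
      then show ?thesis
        by blast
    next
      case 3
      then obtain x where "walk_gain X v w x"
        using connectedD(3)[OF X v(1)] by blast
      then have "?Q w x \<one>"
        using 3 walk_gain_closed[OF XE] by simp
      then show ?thesis
        by blast
    next
      case 4
      then obtain y where "walk_gain Y v w y"
        using connectedD(3)[OF Y v(2)] by blast
      then have "?Q w \<one> y"
        using 4 walk_gain_closed[OF YE] by simp
      then show ?thesis
        by blast
    next
      case 5
      then have "?Q w \<one> \<one>"
        by simp
      then show ?thesis
        by blast
    qed
  qed
  then obtain zx zy where z: "\<And>w. ?Q w (zx w) (zy w)"
    by metis
  define p where "p w = (if w \<in> V X then zx w else zy w)" for w
  have c: "zx w \<in> carrier \<Gamma>" "zy w \<in> carrier \<Gamma>" "p w \<in> carrier \<Gamma>" for w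
    using z by (auto simp: p_def)
  have dev: "p (tail G e) \<otimes> \<psi> e \<otimes> inv (p (head G e)) \<in> H" if e: "e \<in> X \<union> Y" for e
  proof (cases "e \<in> X")
    case True
    then show ?thesis
      using base_walks[OF X v(1) _ _ True, of "zx (tail G e)" "zx (head G e)"] z sub(1)
      by (auto simp: p_def)
  next
    case False
    with e have eY: "e \<in> Y"
      by blast
    then have lab: "\<psi> e \<in> carrier \<Gamma>"
      using YE by auto
    have d: "p w \<otimes> inv (zy w) \<in> H" if "w \<in> V Y" for w
      using z[of w] that c[of w] subgroup.one_closed[OF H] by (simp add: p_def)
    have m: "zy (tail G e) \<otimes> \<psi> e \<otimes> inv (zy (head G e)) \<in> H"
      using base_walks[OF Y v(2) _ _ eY, of "zy (tail G e)" "zy (head G e)"] z sub(2) eY by auto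
    note t = d[OF endpoints_in_V(1)[OF eY]]
    note h = subgroup.m_inv_closed[OF H d[OF endpoints_in_V(2)[OF eY]]]
    show ?thesis
      using subgroup.m_closed[OF H subgroup.m_closed[OF H t m] h] c lab
      by (simp add: m_assoc inv_mult_group)
  qed
  have "potential_modulo H p (X \<union> Y)"
    unfolding potential_modulo_def using c dev by (auto simp: image_subset_iff)
  moreover have "p v = \<one>"
    using z[of v] v by (simp add: p_def)
  moreover have "v \<in> V (X \<union> Y)"
    using v by (simp add: V_Un)
  ultimately show ?thesis
    using gain_group_subset[OF _ _ H] XE YE by simp
qed

section \<open>Pairs of splits\<close>

text \<open>
  Compare two splits at the same vertex \<open>v\<close>. An edge from \<open>v\<close> to \<open>x\<close> that respects \<open>p\<^sub>i\<close> and \<open>q\<^sub>j\<close>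
  forces the ratio \<open>q1 x \<otimes> inv (p1 x)\<close> to be \<open>q\<^sub>j v \<otimes> inv (p\<^sub>i v)\<close>. If the ratio at \<open>x\<close> determines
  \<open>i\<close>, then all edges from \<open>v\<close> to a component off \<open>v\<close> are attached to the same copy of \<open>v\<close>, and
  the translates that merge the two copies form a potential.
\<close>

lemma balanced_if_types_determined:
  assumes P: "P \<subseteq> arcs G" and p: "split_potential v p1 p2 P" and q: "split_potential v q1 q2 P"
    and ne: "p1 v \<noteq> p2 v" "q1 v \<noteq> q2 v"
    and cross: "q2 v \<otimes> inv (p1 v) \<noteq> q1 v \<otimes> inv (p2 v)"
    and det: "\<And>e x. e \<in> P \<Longrightarrow> {tail G e, head G e} = {v, x} \<Longrightarrow> x \<noteq> v \<Longrightarrow>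
      q1 v \<otimes> inv (p1 v) \<noteq> q2 v \<otimes> inv (p2 v) \<or> q1 x \<otimes> inv (p1 x) \<noteq> q1 v \<otimes> inv (p1 v)"
    and loops: "\<And>e. e \<in> P \<Longrightarrow> tail G e = v \<Longrightarrow> head G e = v \<Longrightarrow> \<psi> e = \<one>"
  shows "balanced \<Gamma> G \<psi> P"
proof -
  let ?r = "\<lambda>x. q1 x \<otimes> inv (p1 x)"
  let ?c11 = "q1 v \<otimes> inv (p1 v)" and ?c12 = "q2 v \<otimes> inv (p1 v)"
    and ?c21 = "q1 v \<otimes> inv (p2 v)" and ?c22 = "q2 v \<otimes> inv (p2 v)"
  have c: "p1 w \<in> carrier \<Gamma>" "p2 w \<in> carrier \<Gamma>" "q1 w \<in> carrier \<Gamma>" "q2 w \<in> carrier \<Gamma>" for w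
    using split_potential_closed[OF p] split_potential_closed[OF q] by auto
  have off: "p2 w = p1 w" "q2 w = q1 w" if "w \<noteq> v" for w
    using split_potential_off[OF p that] split_potential_off[OF q that] by auto
  have cs: "?c11 \<noteq> ?c21" "?c12 \<noteq> ?c22"
    using ne c by simp_all
  \<comment> \<open>Components attached to the second copy of \<open>v\<close> are translated to fit the first copy.\<close>
  define s where "s w = (if w \<noteq> v \<and> ?r w \<in> {?c21, ?c22} then p1 v \<otimes> inv (p2 v) \<otimes> p1 w else p1 w)" for w
  have sv: "s v = p1 v"
    by (simp add: s_def)
  have "s (tail G e) \<otimes> \<psi> e = s (head G e)" if e: "e \<in> P" for e
  proof -
    have lab: "\<psi> e \<in> carrier \<Gamma>"
      using e P by auto
    have ratio: "q (tail G e) \<otimes> inv (p (tail G e)) = q (head G e) \<otimes> inv (p (head G e))"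
      if "p (tail G e) \<otimes> \<psi> e = p (head G e)" "q (tail G e) \<otimes> \<psi> e = q (head G e)"
        "range p \<subseteq> carrier \<Gamma>" "range q \<subseteq> carrier \<Gamma>" for p q
      using that lab by (intro ratio_eq[where x = "\<psi> e"]) auto
    have ranges: "range p1 \<subseteq> carrier \<Gamma>" "range p2 \<subseteq> carrier \<Gamma>" "range q1 \<subseteq> carrier \<Gamma>"
      "range q2 \<subseteq> carrier \<Gamma>"
      using c by auto
    consider (off) "tail G e \<noteq> v" "head G e \<noteq> v" | (loop) "tail G e = v" "head G e = v"
      | (out) "tail G e = v" "head G e \<noteq> v" | ("in") "tail G e \<noteq> v" "head G e = v"
      by blast
    then show ?thesis
    proof cases
      case off
      have "p1 (tail G e) \<otimes> \<psi> e = p1 (head G e)" "q1 (tail G e) \<otimes> \<psi> e = q1 (head G e)"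
        using split_potential_off_edge[OF p e off] split_potential_off_edge[OF q e off] by auto
      moreover from this have "?r (tail G e) = ?r (head G e)"
        using ratio ranges by blast
      ultimately show ?thesis
        using off c lab by (auto simp: s_def m_assoc)
    next
      case loop
      then show ?thesis
        using loops[OF e loop] c sv by simp
    next
      case out
      let ?x = "head G e"
      have d: "?c11 \<noteq> ?c22 \<or> ?r ?x \<noteq> ?c11"
        using det[OF e, of ?x] out by auto
      have qtype: "q1 v \<otimes> \<psi> e = q1 ?x \<or> q2 v \<otimes> \<psi> e = q2 ?x"
        using split_potential_nonloop[OF q e] out by auto
      consider (1) "p1 v \<otimes> \<psi> e = p1 ?x" | (2) "p2 v \<otimes> \<psi> e = p2 ?x"
        using split_potential_nonloop[OF p e] out by auto
      then show ?thesis
      proof cases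
        case 1
        then have "?r ?x \<in> {?c11, ?c12}"
          using ratio[of p1 q1] ratio[of p1 q2] ranges out off qtype 1 by auto
        then have "?r ?x \<notin> {?c21, ?c22}"
          using d cs cross by auto
        then show ?thesis
          using 1 out sv by (simp add: s_def)
      next
        case 2
        then have "?r ?x \<in> {?c21, ?c22}"
          using ratio[of p2 q1] ratio[of p2 q2] ranges out off qtype 2 by auto
        then show ?thesis
          using 2[symmetric] out sv off c lab by (simp add: s_def m_assoc)
      qed
    next
      case "in"
      let ?x = "tail G e"
      have d: "?c11 \<noteq> ?c22 \<or> ?r ?x \<noteq> ?c11"
        using det[OF e, of ?x] "in" by auto
      have qtype: "q1 ?x \<otimes> \<psi> e = q1 v \<or> q2 ?x \<otimes> \<psi> e = q2 v"
        using split_potential_nonloop[OF q e] "in" by auto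
      consider (1) "p1 ?x \<otimes> \<psi> e = p1 v" | (2) "p2 ?x \<otimes> \<psi> e = p2 v"
        using split_potential_nonloop[OF p e] "in" by auto
      then show ?thesis
      proof cases
        case 1
        then have "?r ?x \<in> {?c11, ?c12}"
          using ratio[of p1 q1] ratio[of p1 q2] ranges "in" off qtype 1 by auto
        then have "?r ?x \<notin> {?c21, ?c22}"
          using d cs cross by auto
        then show ?thesis
          using 1 "in" sv by (simp add: s_def)
      next
        case 2
        then have "?r ?x \<in> {?c21, ?c22}"
          using ratio[of p2 q1] ratio[of p2 q2] ranges "in" off qtype 2 by auto
        then show ?thesis
          using 2 "in" sv off c lab by (simp add: s_def m_assoc)
      qed
    qed
  qed
  then have "potential s P"
    using c by (auto simp: potential_def s_def)
  then show ?thesis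
    using potential_imp_balanced[OF P] by blast
qed

text \<open>
  If the two diagonal ratios differ, then all four ratios differ and \<open>X \<inter> Y\<close> would be balanced by
  the previous lemma. So they agree. A component with this common ratio is attached in the same
  way by both splits, and the others form a balanced set \<open>P\<close>. If \<open>P\<close> is empty, a translation makes
  the two splits agree on \<open>X \<inter> Y\<close>.
\<close>

lemma split_or_cut_vertex_aligned:
  assumes X: "X \<subseteq> arcs G" and p: "split_potential v p1 p2 X" and q: "split_potential v q1 q2 Y"
    and ne: "p1 v \<noteq> p2 v" "q1 v \<noteq> q2 v" and unb: "\<not> balanced \<Gamma> G \<psi> (X \<inter> Y)"
    and cross: "q2 v \<otimes> inv (p1 v) \<noteq> q1 v \<otimes> inv (p2 v)"
    and V: "V X \<inter> V Y = V (X \<inter> Y)"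
  shows "(\<exists>r1 r2. split_potential v r1 r2 (X \<union> Y)) \<or>
    (\<exists>P Q. X \<inter> Y = P \<union> Q \<and> P \<inter> Q = {} \<and> P \<noteq> {} \<and> Q \<noteq> {} \<and> V P \<inter> V Q \<subseteq> {v} \<and>
       balanced \<Gamma> G \<psi> P)"
proof -
  let ?F = "X \<inter> Y" and ?c11 = "q1 v \<otimes> inv (p1 v)" and ?c22 = "q2 v \<otimes> inv (p2 v)"
  have F: "?F \<subseteq> arcs G"
    using X by blast
  have c: "p1 w \<in> carrier \<Gamma>" "p2 w \<in> carrier \<Gamma>" "q1 w \<in> carrier \<Gamma>" "q2 w \<in> carrier \<Gamma>" for w
    using split_potential_closed[OF p] split_potential_closed[OF q] by auto
  have off: "p2 w = p1 w" "q2 w = q1 w" if "w \<noteq> v" for w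
    using split_potential_off[OF p that] split_potential_off[OF q that] by auto
  note pF = split_potential_mono[OF p Int_lower1, of Y]
    and qF = split_potential_mono[OF q Int_lower2, of X]
  have diag: "?c11 = ?c22"
  proof (rule ccontr)
    assume diag: "?c11 \<noteq> ?c22"
    have "\<psi> e = \<one>" if e: "e \<in> ?F" "tail G e = v" "head G e = v" for e
    proof (rule ccontr)
      assume n1: "\<psi> e \<noteq> \<one>"
      have lab: "\<psi> e \<in> carrier \<Gamma>"
        using e F by auto
      have "\<not> p1 v \<otimes> \<psi> e = p1 v" "\<not> p2 v \<otimes> \<psi> e = p2 v" "\<not> q1 v \<otimes> \<psi> e = q1 v" "\<not> q2 v \<otimes> \<psi> e = q2 v"
        using n1 lab c by auto
      then have "p1 v \<otimes> \<psi> e = p2 v \<or> p2 v \<otimes> \<psi> e = p1 v" "q1 v \<otimes> \<psi> e = q2 v \<or> q2 v \<otimes> \<psi> e = q1 v"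
        using pF qF e unfolding split_potential_def by metis+
      then show False
        using ratio_eq[OF _ _ _ _ lab] c cross diag by metis
    qed
    then have "balanced \<Gamma> G \<psi> ?F"
      using diag by (intro balanced_if_types_determined[OF F pF qF ne cross]) auto
    with unb show False ..
  qed
  let ?r = "\<lambda>x. q1 x \<otimes> inv (p1 x)"
  define T where "T = {x. x \<noteq> v \<and> ?r x \<noteq> ?c11}"
  define P where "P = {e \<in> ?F. tail G e \<in> T \<or> head G e \<in> T}"
  define Q where "Q = ?F - P"
  have T_closed: "tail G e \<in> T \<longleftrightarrow> head G e \<in> T"
    if e: "e \<in> ?F" "tail G e \<noteq> v" "head G e \<noteq> v" for e
  proof -
    have lab: "\<psi> e \<in> carrier \<Gamma>"
      using e F by auto
    have "?r (tail G e) = ?r (head G e)"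
      using ratio_eq[OF split_potential_off_edge[OF pF e] split_potential_off_edge[OF qF e]] c lab
      by blast
    then show ?thesis
      using e by (simp add: T_def)
  qed
  have share: "V P \<inter> V Q \<subseteq> {v}"
  proof
    fix x
    assume "x \<in> V P \<inter> V Q"
    then obtain e f where e: "e \<in> P" "x = tail G e \<or> x = head G e"
      and f: "f \<in> Q" "x = tail G f \<or> x = head G f"
      by (auto elim!: V_cases)
    have "x \<notin> T"
      using f by (auto simp: P_def Q_def)
    moreover have "v \<notin> T"
      by (simp add: T_def)
    ultimately show "x \<in> {v}"
      using e T_closed[of e] by (auto simp: P_def)
  qed
  have P: "P \<subseteq> ?F" "P \<subseteq> arcs G"
    using F by (auto simp: P_def)
  have bal: "balanced \<Gamma> G \<psi> P"
  proof (rule balanced_if_types_determined[OF P(2) split_potential_mono[OF pF P(1)]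
        split_potential_mono[OF qF P(1)] ne cross])
    fix e x
    assume "e \<in> P" "{tail G e, head G e} = {v, x}" "x \<noteq> v"
    then have "x \<in> T"
      by (auto simp: P_def T_def doubleton_eq_iff)
    then show "?c11 \<noteq> ?c22 \<or> ?r x \<noteq> ?c11"
      by (simp add: T_def)
  qed (auto simp: P_def T_def)
  then have "Q \<noteq> {}"
    using unb P(1) unfolding Q_def by (metis Diff_eq_empty_iff subset_antisym)
  show ?thesis
  proof (cases "P = {}")
    case True
    have r: "?r x = ?c11" if "x \<in> V ?F" "x \<noteq> v" for x
      using that True by (auto simp: P_def T_def elim!: V_cases)
    let ?p1 = "\<lambda>w. ?c11 \<otimes> p1 w" and ?p2 = "\<lambda>w. ?c11 \<otimes> p2 w"
    have sp: "split_potential v ?p1 ?p2 X"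
      using split_potential_translate[OF X p] c by simp
    have agree: "?p1 x = q1 x \<and> ?p2 x = q2 x" if "x \<in> V X" "x \<in> V Y" for x
    proof (cases "x = v")
      case True
      have "?c11 \<otimes> p1 v = q1 v" "?c22 \<otimes> p2 v = q2 v"
        using c by (simp_all add: m_assoc)
      then show ?thesis
        using True diag by simp
    next
      case False
      have "?r x \<otimes> p1 x = q1 x"
        using c by (simp add: m_assoc)
      moreover have "?r x = ?c11"
        using r[OF _ False] that V by blast
      ultimately show ?thesis
        using off[OF False] by metis
    qed
    show ?thesis
      using split_potential_glue[OF sp q agree] by simp
  next
    case False
    moreover have "?F = P \<union> Q" "P \<inter> Q = {}"
      by (auto simp: P_def Q_def)
    ultimately show ?thesis
      using share bal \<open>Q \<noteq> {}\<close> by blast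
  qed
qed

text \<open>
  The diagonal and the antidiagonal ratios can both agree only if the gain between the two copies
  of \<open>v\<close> has the identity as its square. As it has not, at least one pair differs; exchanging the
  two copies in one of the splits if necessary, let this be the antidiagonal pair.
\<close>

lemma split_or_cut_vertex:
  assumes X: "X \<subseteq> arcs G" and p: "split_potential v p1 p2 X" and q: "split_potential v q1 q2 Y"
    and sq: "(inv (p1 v) \<otimes> p2 v) \<otimes> (inv (p1 v) \<otimes> p2 v) \<noteq> \<one>" and ne: "q1 v \<noteq> q2 v"
    and unb: "\<not> balanced \<Gamma> G \<psi> (X \<inter> Y)" and V: "V X \<inter> V Y = V (X \<inter> Y)"
  shows "(\<exists>r1 r2. split_potential v r1 r2 (X \<union> Y)) \<or>
    (\<exists>P Q. X \<inter> Y = P \<union> Q \<and> P \<inter> Q = {} \<and> P \<noteq> {} \<and> Q \<noteq> {} \<and> V P \<inter> V Q \<subseteq> {v} \<and>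
       balanced \<Gamma> G \<psi> P)"
proof -
  have c: "p1 v \<in> carrier \<Gamma>" "p2 v \<in> carrier \<Gamma>" "q1 v \<in> carrier \<Gamma>" "q2 v \<in> carrier \<Gamma>"
    using split_potential_closed[OF p] split_potential_closed[OF q] by auto
  have ne': "p1 v \<noteq> p2 v"
    using sq c by auto
  have flip: "inv (p1 v) \<otimes> p2 v = inv a \<otimes> b"
    if "a \<otimes> inv (p1 v) = b \<otimes> inv (p2 v)" "a \<in> carrier \<Gamma>" "b \<in> carrier \<Gamma>" for a b
  proof -
    have "a = b \<otimes> inv (p2 v) \<otimes> p1 v"
      using that c by (metis inv_solve_right' inv_closed m_closed inv_inv)
    then show ?thesis
      using that c by (simp add: inv_mult_group m_assoc)
  qed
  have "q2 v \<otimes> inv (p1 v) \<noteq> q1 v \<otimes> inv (p2 v) \<or> q1 v \<otimes> inv (p1 v) \<noteq> q2 v \<otimes> inv (p2 v)"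
  proof (rule ccontr)
    assume "\<not> ?thesis"
    then have "inv (p1 v) \<otimes> p2 v = inv (q2 v) \<otimes> q1 v" "inv (p1 v) \<otimes> p2 v = inv (q1 v) \<otimes> q2 v"
      using flip c by blast+
    then have "(inv (p1 v) \<otimes> p2 v) \<otimes> (inv (p1 v) \<otimes> p2 v) = (inv (q2 v) \<otimes> q1 v) \<otimes> (inv (q1 v) \<otimes> q2 v)"
      by simp
    also have "\<dots> = \<one>"
      using c by (simp add: m_assoc)
    finally show False
      using sq by simp
  qed
  then show ?thesis
    using split_or_cut_vertex_aligned[OF X p q ne' ne unb _ V]
      split_or_cut_vertex_aligned[OF X p split_potential_swap[OF q] ne' ne[symmetric] unb _ V]
    by blast
qed

text \<open>
  Off \<open>v\<close> and \<open>w\<close> the ratio is constant on components. Edges from \<open>v\<close> to a component respect \<open>p1\<close>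
  iff its ratio is \<open>q1 v \<otimes> inv (p1 v)\<close>. The components with this ratio, together with the edges
  between \<open>v\<close> and \<open>w\<close> that respect \<open>p1\<close>, form \<open>P\<close>, for which \<open>p1\<close> is a potential, and \<open>p2\<close> is one
  for the rest. A loop at \<open>v\<close> is balanced because \<open>q1\<close> is a potential there.
\<close>

lemma two_balanced_parts:
  assumes F: "F \<subseteq> arcs G" and p: "split_potential v p1 p2 F" and q: "split_potential w q1 q2 F"
    and ne: "p1 v \<noteq> p2 v" and vw: "v \<noteq> w" and unb: "\<not> balanced \<Gamma> G \<psi> F"
  shows "\<exists>P Q. F = P \<union> Q \<and> P \<inter> Q = {} \<and> P \<noteq> {} \<and> Q \<noteq> {} \<and> V P \<inter> V Q \<subseteq> {v, w} \<and>
    balanced \<Gamma> G \<psi> P \<and> balanced \<Gamma> G \<psi> Q"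
proof -
  let ?r = "\<lambda>x. q1 x \<otimes> inv (p1 x)" and ?c1 = "q1 v \<otimes> inv (p1 v)"
  have c: "p1 x \<in> carrier \<Gamma>" "p2 x \<in> carrier \<Gamma>" "q1 x \<in> carrier \<Gamma>" for x
    using split_potential_closed[OF p] split_potential_closed[OF q] by auto
  have off: "p2 x = p1 x" if "x \<noteq> v" for x
    using split_potential_off[OF p that] .
  have lab: "\<psi> e \<in> carrier \<Gamma>" if "e \<in> F" for e
    using that F by auto
  have qe: "q1 (tail G e) \<otimes> \<psi> e = q1 (head G e)" if "e \<in> F" "tail G e \<noteq> w" "head G e \<noteq> w" for e
    using split_potential_off_edge[OF q that] .
  have ratio1: "?r (tail G e) = ?r (head G e)"
    if "e \<in> F" "tail G e \<noteq> w" "head G e \<noteq> w" "p1 (tail G e) \<otimes> \<psi> e = p1 (head G e)" for e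
    using ratio_eq[OF that(4) qe[OF that(1-3)]] c lab[OF that(1)] by blast
  have ratio2: "q1 (tail G e) \<otimes> inv (p2 (tail G e)) = q1 (head G e) \<otimes> inv (p2 (head G e))"
    if "e \<in> F" "tail G e \<noteq> w" "head G e \<noteq> w" "p2 (tail G e) \<otimes> \<psi> e = p2 (head G e)" for e
    using ratio_eq[OF that(4) qe[OF that(1-3)]] c lab[OF that(1)] by blast
  have off_edge: "p1 (tail G e) \<otimes> \<psi> e = p1 (head G e)"
    if "e \<in> F" "tail G e \<noteq> v" "head G e \<noteq> v" for e
    using split_potential_off_edge[OF p that] .
  define T where "T = {x. x \<noteq> v \<and> x \<noteq> w \<and> ?r x = ?c1}"
  define P where "P = {e \<in> F. tail G e \<in> T \<or> head G e \<in> T \<or>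
    tail G e \<in> {v, w} \<and> head G e \<in> {v, w} \<and> p1 (tail G e) \<otimes> \<psi> e = p1 (head G e)}"
  define Q where "Q = F - P"
  have T_closed: "tail G e \<in> T \<longleftrightarrow> head G e \<in> T"
    if "e \<in> F" "tail G e \<notin> {v, w}" "head G e \<notin> {v, w}" for e
    using ratio1[OF that(1) _ _ off_edge[OF that(1)]] that by (auto simp: T_def)
  have share: "V P \<inter> V Q \<subseteq> {v, w}"
  proof
    fix x
    assume "x \<in> V P \<inter> V Q"
    then obtain e f where e: "e \<in> P" "x = tail G e \<or> x = head G e"
      and f: "f \<in> Q" "x = tail G f \<or> x = head G f"
      by (auto elim!: V_cases)
    have "x \<notin> T"
      using f by (auto simp: P_def Q_def)
    moreover have "v \<notin> T" "w \<notin> T"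
      by (simp_all add: T_def)
    ultimately show "x \<in> {v, w}"
      using e T_closed[of e] by (auto simp: P_def)
  qed
  have "p1 (tail G e) \<otimes> \<psi> e = p1 (head G e)" if "e \<in> P" for e
  proof (rule ccontr)
    assume bad: "\<not> ?thesis"
    have e: "e \<in> F" "tail G e \<in> T \<or> head G e \<in> T"
      using that bad by (auto simp: P_def)
    have at_v: "tail G e = v \<or> head G e = v"
      using off_edge[OF e(1)] bad by blast
    then have nw: "tail G e \<noteq> w" "head G e \<noteq> w" and nl: "tail G e \<noteq> head G e"
      using e(2) vw by (auto simp: T_def)
    then have "p2 (tail G e) \<otimes> \<psi> e = p2 (head G e)"
      using split_potential_nonloop[OF p e(1)] bad by blast
    from ratio2[OF e(1) nw this] have "?c1 = q1 v \<otimes> inv (p2 v)"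
      using at_v e(2) off by (auto simp: T_def)
    then show False
      using ne c by simp
  qed
  then have pot1: "potential p1 P"
    using c by (auto simp: potential_def)
  have "p2 (tail G e) \<otimes> \<psi> e = p2 (head G e)" if "e \<in> Q" for e
  proof (cases "tail G e = v \<or> head G e = v")
    case False
    then show ?thesis
      using off_edge[of e] off that by (auto simp: Q_def)
  next
    case True
    have e: "e \<in> F" "tail G e \<notin> T" "head G e \<notin> T"
      using that by (auto simp: P_def Q_def)
    have "\<not> p1 (tail G e) \<otimes> \<psi> e = p1 (head G e)"
    proof
      assume fits: "p1 (tail G e) \<otimes> \<psi> e = p1 (head G e)"
      then have nvw: "tail G e \<notin> {v, w} \<or> head G e \<notin> {v, w}"
        using that by (auto simp: P_def Q_def)
      then have "tail G e \<noteq> w" "head G e \<noteq> w"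
        using True vw by auto
      from ratio1[OF e(1) this fits] show False
        using e True nvw by (auto simp: T_def)
    qed
    moreover have "tail G e \<noteq> head G e"
    proof
      assume "tail G e = head G e"
      then have "q1 v \<otimes> \<psi> e = q1 v"
        using qe[OF e(1)] True vw by auto
      then have "\<psi> e = \<one>"
        using c lab[OF e(1)] by simp
      then show False
        using calculation c \<open>tail G e = head G e\<close> by simp
    qed
    ultimately show ?thesis
      using split_potential_nonloop[OF p e(1)] by blast
  qed
  then have pot2: "potential p2 Q"
    using c by (auto simp: potential_def)
  have PQ: "P \<subseteq> arcs G" "Q \<subseteq> arcs G" "F = P \<union> Q" "P \<inter> Q = {}"
    using F by (auto simp: P_def Q_def)
  have "balanced \<Gamma> G \<psi> P" "balanced \<Gamma> G \<psi> Q"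
    using potential_imp_balanced PQ pot1 pot2 by blast+
  moreover from this have "P \<noteq> {}" "Q \<noteq> {}"
    using unb PQ(3) by auto
  ultimately show ?thesis
    using PQ share by blast
qed

end

text \<open>
  A trivial gain group makes the walk gains from \<open>v\<close> a potential.
\<close>

lemma (in labeled_graph) gain_group_trivial_iff:
  assumes F: "F \<in> connected_edge_sets G" and v: "v \<in> V F"
  shows "gain_group \<Gamma> G \<psi> F v = {\<one>} \<longleftrightarrow> balanced \<Gamma> G \<psi> F"
proof
  note FE = connectedD(1)[OF F]
  assume triv: "gain_group \<Gamma> G \<psi> F v = {\<one>}"
  have "\<exists>x. x \<in> carrier \<Gamma> \<and> (w \<in> V F \<longrightarrow> walk_gain F v w x)" for w
    using connectedD(3)[OF F v, of w] walk_gain_closed[OF FE, of v w] one_closed by meson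
  then obtain z where z: "\<And>w. z w \<in> carrier \<Gamma>" "\<And>w. w \<in> V F \<Longrightarrow> walk_gain F v w (z w)"
    by metis
  have "z (tail G e) \<otimes> \<psi> e = z (head G e)" if e: "e \<in> F" for e
  proof -
    have "z (tail G e) \<otimes> \<psi> e \<otimes> inv (z (head G e)) = \<one>"
      using base_walks[OF F v z(2) z(2) e] e triv by simp
    moreover have "\<psi> e \<in> carrier \<Gamma>"
      using e FE by auto
    ultimately show ?thesis
      using z(1) by (metis inv_closed inv_equality inv_inv m_closed)
  qed
  then have "potential z F"
    using z(1) by (auto simp: potential_def)
  then show "balanced \<Gamma> G \<psi> F"
    using potential_imp_balanced[OF FE] by blast
next
  note FE = connectedD(1)[OF F]
  assume "balanced \<Gamma> G \<psi> F"
  then obtain p where p: "potential p F"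
    using balanced_iff_potential[OF FE] by blast
  have "x = \<one>" if "walk_gain F v v x" for x
    using walk_gain_potential[OF FE p that] walk_gain_closed[OF FE that] potential_closed[OF p, of v]
    by simp
  then show "gain_group \<Gamma> G \<psi> F v = {\<one>}"
    using gain_group_eq[OF FE v] walk_gain_refl[OF v] by blast
qed

section \<open>The polymatroidal function and the count function\<close>

locale count_function = labeled_graph \<Gamma> G \<psi> + fin_digraph G
  for \<Gamma> :: "('g, 'm) monoid_scheme" (structure) and G :: "('v, 'e) pre_digraph" and \<psi> :: "'e \<Rightarrow> 'g" +
  fixes k l :: int and \<alpha> :: "'g set \<Rightarrow> int"
  assumes k_pos: "k \<ge> 1" and l_nonneg: "0 \<le> l" and l_less: "l \<le> 2 * k - 1"
    and alpha_range: "\<alpha> ` Pow (carrier \<Gamma>) \<subseteq> {0..l}"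
    and alpha_normalized: "normalized_polymatroidal \<Gamma> \<alpha>"
    and alpha_smooth: "\<And>S g. S \<noteq> {} \<Longrightarrow> S \<subseteq> carrier \<Gamma> \<Longrightarrow> g \<in> carrier \<Gamma> \<Longrightarrow>
      \<alpha> (S \<union> {g}) - \<alpha> S > k \<Longrightarrow> S = {\<one>} \<and> g [^] (2::nat) \<noteq> \<one>"
begin

abbreviation bal :: "'e set \<Rightarrow> bool" where
  "bal F \<equiv> balanced \<Gamma> G \<psi> F"

abbreviation gains :: "'e set \<Rightarrow> 'v \<Rightarrow> 'g set" where
  "gains F v \<equiv> gain_group \<Gamma> G \<psi> F v"

abbreviation group_rank :: "'e set \<Rightarrow> int" where
  "group_rank F \<equiv> alpha_tilde \<Gamma> G \<psi> \<alpha> F"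

abbreviation count :: "'e set \<Rightarrow> int" where
  "count F \<equiv> f_alpha \<Gamma> G \<psi> k l \<alpha> F"

abbreviation indep :: "'e set set" where
  "indep \<equiv> I_alpha \<Gamma> G \<psi> k l \<alpha>"

abbreviation conn :: "'e set set" where
  "conn \<equiv> connected_edge_sets G"

lemma alpha_bounds: "X \<subseteq> carrier \<Gamma> \<Longrightarrow> 0 \<le> \<alpha> X" "X \<subseteq> carrier \<Gamma> \<Longrightarrow> \<alpha> X \<le> l"
  using alpha_range by (auto simp: image_subset_iff)

lemma alpha_submodular:
    "X \<subseteq> carrier \<Gamma> \<Longrightarrow> Y \<subseteq> carrier \<Gamma> \<Longrightarrow> \<alpha> (X \<union> Y) + \<alpha> (X \<inter> Y) \<le> \<alpha> X + \<alpha> Y"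
  and alpha_mono: "X \<subseteq> Y \<Longrightarrow> Y \<subseteq> carrier \<Gamma> \<Longrightarrow> \<alpha> X \<le> \<alpha> Y"
  and alpha_conj: "X \<subseteq> carrier \<Gamma> \<Longrightarrow> g \<in> carrier \<Gamma> \<Longrightarrow> \<alpha> ((g <# X) #> inv g) = \<alpha> X"
  and alpha_generate: "X \<subseteq> carrier \<Gamma> \<Longrightarrow> \<alpha> (generate \<Gamma> X) = \<alpha> X"
  and alpha_one: "\<alpha> {\<one>} = 0"
  using alpha_normalized unfolding normalized_polymatroidal_def polymatroidal_def by auto

lemma alpha_insert:
  assumes "S \<noteq> {}" "S \<noteq> {\<one>}" "S \<subseteq> carrier \<Gamma>" "g \<in> carrier \<Gamma>"
  shows "\<alpha> (S \<union> {g}) \<le> \<alpha> S + k"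
  using alpha_smooth[OF assms(1,3,4)] assms(2) by linarith

text \<open>
  This is the exceptional case of smoothness, applied to the trivial group.
\<close>

lemma alpha_large_not_involution:
  assumes "g \<in> carrier \<Gamma>" "k < \<alpha> {g}"
  shows "g \<otimes> g \<noteq> \<one>"
proof -
  have "\<alpha> {g} \<le> \<alpha> ({\<one>} \<union> {g})"
    using assms(1) by (intro alpha_mono) auto
  then have "g [^] (2::nat) \<noteq> \<one>"
    using alpha_smooth[of "{\<one>}" g] alpha_one assms by auto
  then show ?thesis
    using assms(1) by (simp add: numeral_2_eq_2)
qed

lemma gains_carrier: "F \<in> conn \<Longrightarrow> v \<in> V F \<Longrightarrow> gains F v \<subseteq> carrier \<Gamma>"
  using subgroup_gain_group[OF connectedD(1)] subgroup.subset by blast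

lemma alpha_tilde_base:
  assumes F: "F \<in> conn" and v: "v \<in> V F"
  shows "group_rank F = \<alpha> (gains F v)"
proof -
  define u where "u = (SOME v. v \<in> V F)"
  have u: "u \<in> V F"
    unfolding u_def using v by (rule someI)
  obtain x where x: "walk_gain F u v x"
    using connectedD(3)[OF F u v] by blast
  have "\<alpha> (gains F u) = \<alpha> (gains F v)"
    unfolding gain_group_conj[OF connectedD(1)[OF F] x]
    using alpha_conj[OF gains_carrier[OF F v]] walk_gain_closed[OF connectedD(1)[OF F] x] by blast
  then show ?thesis
    by (simp add: alpha_tilde_def u_def)
qed

lemma conn_vertex:
  assumes "F \<in> conn"
  obtains v where "v \<in> V F"
  using connectedD(2)[OF assms] endpoints_in_V by blast

lemma alpha_tilde_bounds:
  assumes "F \<in> conn"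
  shows "0 \<le> group_rank F" "group_rank F \<le> l"
  using conn_vertex[OF assms] alpha_tilde_base[OF assms] alpha_bounds[OF gains_carrier[OF assms]]
  by metis+

lemma alpha_tilde_mono:
  assumes F: "F \<in> conn" "F' \<in> conn" "F \<subseteq> F'"
  shows "group_rank F \<le> group_rank F'"
proof -
  obtain v where v: "v \<in> V F"
    using conn_vertex[OF F(1)] .
  then have v': "v \<in> V F'"
    using V_mono[OF F(3)] by blast
  show ?thesis
    using alpha_tilde_base[OF F(1) v] alpha_tilde_base[OF F(2) v']
      alpha_mono[OF gain_group_mono[OF F(3) connectedD(1)[OF F(2)] v] gains_carrier[OF F(2) v']]
    by simp
qed

lemma alpha_tilde_balanced:
  assumes "F \<in> conn" "bal F"
  shows "group_rank F = 0"
  using conn_vertex[OF assms(1)] alpha_tilde_base[OF assms(1)] gain_group_trivial_iff[OF assms(1)]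
    assms(2) alpha_one by metis

definition \<beta> :: "'e set \<Rightarrow> int" where
  "\<beta> F = (if near_balanced \<Gamma> G \<psi> F then min (group_rank F) k else group_rank F)"

lemma count_eq: "count F = k * int (card (V F)) - l + \<beta> F"
  by (simp add: f_alpha_def \<beta>_def)

lemma beta_le_alpha_tilde: "\<beta> F \<le> group_rank F"
  by (simp add: \<beta>_def)

lemma beta_bounds:
  assumes "F \<in> conn"
  shows "0 \<le> \<beta> F" "\<beta> F \<le> l"
  using alpha_tilde_bounds[OF assms] k_pos by (auto simp: \<beta>_def)

lemma beta_balanced: "F \<in> conn \<Longrightarrow> bal F \<Longrightarrow> \<beta> F = 0"
  using alpha_tilde_balanced k_pos by (simp add: \<beta>_def)

lemma beta_split:
  assumes "F \<in> conn" "v \<in> verts G" "split_potential v p1 p2 F"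
  shows "\<beta> F \<le> k"
proof (cases "bal F")
  case True
  then show ?thesis
    using beta_balanced[OF assms(1)] k_pos by simp
next
  case False
  then have "near_balanced \<Gamma> G \<psi> F"
    using near_balanced_iff assms by blast
  then show ?thesis
    by (simp add: \<beta>_def)
qed

text \<open>
  A subset of a near-balanced set becomes balanced by the same split, so the cap is inherited.
\<close>

lemma beta_mono:
  assumes F: "F \<in> conn" "F' \<in> conn" "F \<subseteq> F'"
  shows "\<beta> F \<le> \<beta> F'"
proof (cases "near_balanced \<Gamma> G \<psi> F'")
  case True
  then obtain v p1 p2 where v: "v \<in> verts G" "split_potential v p1 p2 F'"
    using near_balanced_iff by blast
  then have "\<beta> F \<le> k"
    using beta_split[OF F(1)] split_potential_mono[OF v(2) F(3)] by blast
  then show ?thesis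
    using True beta_le_alpha_tilde[of F] alpha_tilde_mono[OF F] by (simp add: \<beta>_def)
next
  case False
  then show ?thesis
    using beta_le_alpha_tilde[of F] alpha_tilde_mono[OF F] by (simp add: \<beta>_def)
qed

text \<open>
  The sets on which the cap makes a difference, so that submodularity of \<open>\<alpha>\<close> does not carry over
  to \<open>\<beta>\<close>.
\<close>

definition capped :: "'e set \<Rightarrow> bool" where
  "capped F \<longleftrightarrow> near_balanced \<Gamma> G \<psi> F \<and> k < group_rank F"

lemma beta_capped: "\<beta> F = (if capped F then k else group_rank F)"
  by (auto simp: \<beta>_def capped_def)

lemma cappedE:
  assumes "capped F"
  obtains v p1 p2 where "v \<in> verts G" "v \<in> V F" "split_potential v p1 p2 F"
    "inv (p1 v) \<otimes> p2 v \<in> carrier \<Gamma>"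
    "(inv (p1 v) \<otimes> p2 v) \<otimes> (inv (p1 v) \<otimes> p2 v) \<noteq> \<one>" "p1 v \<noteq> p2 v"
    "gains F v \<subseteq> generate \<Gamma> {inv (p1 v) \<otimes> p2 v}"
proof -
  have nb: "near_balanced \<Gamma> G \<psi> F" and large: "k < group_rank F"
    using assms by (auto simp: capped_def)
  then have F: "F \<in> conn" "\<not> bal F"
    by (auto simp: near_balanced_def)
  obtain v p1 p2 where v: "v \<in> verts G" and p: "split_potential v p1 p2 F"
    using nb near_balanced_iff by blast
  have vF: "v \<in> V F"
    using unbalanced_subset_generator(1)[OF F(1) p F(2)] .
  let ?g = "inv (p1 v) \<otimes> p2 v"
  have c: "p1 v \<in> carrier \<Gamma>" "p2 v \<in> carrier \<Gamma>"
    using split_potential_closed[OF p] by auto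
  have gen: "gains F v \<subseteq> generate \<Gamma> {?g}"
    using gain_group_split[OF connectedD(1)[OF F(1)] p vF] c by (simp add: m_assoc)
  have "group_rank F \<le> \<alpha> (generate \<Gamma> {?g})"
    unfolding alpha_tilde_base[OF F(1) vF]
    using c by (intro alpha_mono[OF gen] generate_incl) simp
  also have "\<dots> = \<alpha> {?g}"
    using c by (intro alpha_generate) simp
  finally have "?g \<otimes> ?g \<noteq> \<one>"
    using alpha_large_not_involution[of ?g] c large by simp
  moreover from this have "p1 v \<noteq> p2 v"
    using c by auto
  ultimately show thesis
    using that[OF v vF p] gen c by simp
qed

section \<open>Independent sets\<close>

lemma indepD:
  assumes "I \<in> indep"
  shows "I \<subseteq> arcs G" "\<And>F. F \<in> conn \<Longrightarrow> F \<subseteq> I \<Longrightarrow> int (card F) \<le> count F"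
  using assms by (auto simp: I_alpha_def)

lemma indep_subset: "J \<in> indep \<Longrightarrow> I \<subseteq> J \<Longrightarrow> I \<in> indep"
  unfolding I_alpha_def by blast

lemma finite_arcs_subset: "F \<subseteq> arcs G \<Longrightarrow> finite F"
  using finite_edges finite_subset by blast

text \<open>
  Also for a disconnected set the bound is that of a single connected set: each further component
  only contributes \<open>b - l \<le> 0\<close>. This is why the parts in an uncrossing argument need not be
  connected.
\<close>

lemma card_independent_le:
  assumes I: "I \<in> indep" and b: "b \<le> l"
    and "P \<subseteq> I" "P \<noteq> {}" "\<And>C. C \<in> conn \<Longrightarrow> C \<subseteq> P \<Longrightarrow> \<beta> C \<le> b"
  shows "int (card P) \<le> k * int (card (V P)) - l + b"
proof -
  have "finite P"
    using assms(3) indepD(1)[OF I] finite_arcs_subset by blast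
  then show ?thesis
    using assms(3-)
  proof (induction P rule: finite_psubset_induct)
    case (psubset P)
    have PE: "P \<subseteq> arcs G"
      using psubset.prems(1) indepD(1)[OF I] by blast
    show ?case
    proof (cases "P \<in> conn")
      case True
      then show ?thesis
        using indepD(2)[OF I True psubset.prems(1)] psubset.prems(3)[OF True] by (simp add: count_eq)
    next
      case False
      obtain A B where AB: "P = A \<union> B" "A \<inter> B = {}" "A \<noteq> {}" "B \<noteq> {}" "V A \<inter> V B = {}"
        using disconnected_split[OF PE psubset.prems(2) False] .
      have "int (card A) \<le> k * int (card (V A)) - l + b"
        using AB psubset.prems by (intro psubset.IH) auto
      moreover have "int (card B) \<le> k * int (card (V B)) - l + b"
        using AB psubset.prems by (intro psubset.IH) auto
      moreover have "card P = card A + card B"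
        using AB psubset.hyps by (simp add: card_Un_disjoint)
      moreover have "card (V P) = card (V A) + card (V B)"
        using AB PE by (simp add: V_Un card_Un_disjoint finite_V)
      ultimately show ?thesis
        using b by (simp add: algebra_simps)
    qed
  qed
qed

text \<open>
  The hypothesis on singletons takes care of the case that \<open>I\<close> and \<open>F\<close> are disjoint, where the
  right-hand side has to be nonnegative.
\<close>

lemma card_independent_Int_le:
  assumes I: "I \<in> indep" and b: "b \<le> l" and F: "F \<subseteq> arcs G" "F \<noteq> {}"
    and nonloop: "\<And>e. e \<in> F \<Longrightarrow> {e} \<in> indep"
    and bound: "\<And>C. C \<in> conn \<Longrightarrow> C \<subseteq> F \<Longrightarrow> \<beta> C \<le> b"
  shows "int (card (I \<inter> F)) \<le> k * int (card (V F)) - l + b"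
proof -
  have mono: "k * int (card (V F')) \<le> k * int (card (V F))" if "F' \<subseteq> F" for F'
    using card_mono[OF finite_V[OF F(1)] V_mono[OF that]] k_pos by simp
  show ?thesis
  proof (cases "I \<inter> F = {}")
    case True
    obtain e where e: "e \<in> F"
      using F(2) by blast
    then have conn: "{e} \<in> conn"
      using connected_singleton F(1) by blast
    have "1 \<le> count {e}"
      using indepD(2)[OF nonloop[OF e] conn] by simp
    then show ?thesis
      using True mono[of "{e}"] bound[OF conn] e by (simp add: count_eq)
  next
    case False
    have "int (card (I \<inter> F)) \<le> k * int (card (V (I \<inter> F))) - l + b"
      using False bound by (intro card_independent_le[OF I b]) auto
    then show ?thesis
      using mono[of "I \<inter> F"] by simp
  qed
qed

end

section \<open>Uncrossing\<close>

context labeled_graph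
begin

lemma gain_group_Un_subset:
  assumes X: "X \<in> connected_edge_sets G" and Y: "Y \<in> connected_edge_sets G"
    and F: "X \<inter> Y \<in> connected_edge_sets G" and V: "V X \<inter> V Y = V (X \<inter> Y)"
    and v: "v \<in> V (X \<inter> Y)" and H: "subgroup H \<Gamma>"
    and sub: "gain_group \<Gamma> G \<psi> X v \<subseteq> H" "gain_group \<Gamma> G \<psi> Y v \<subseteq> H"
  shows "gain_group \<Gamma> G \<psi> (X \<union> Y) v \<subseteq> H"
proof (rule gain_group_Un[OF X Y _ _ H sub])
  note XE = connectedD(1)[OF X] and YE = connectedD(1)[OF Y]
  show "v \<in> V X" "v \<in> V Y"
    using v V by auto
  fix w
  assume "w \<in> V X" "w \<in> V Y"
  then have "w \<in> V (X \<inter> Y)"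
    using V by blast
  then obtain x where x: "walk_gain (X \<inter> Y) v w x"
    using connectedD(3)[OF F v] by blast
  have "x \<otimes> inv x \<in> H"
    using walk_gain_closed[OF connectedD(1)[OF F] x] subgroup.one_closed[OF H] by simp
  then show "\<exists>x y. walk_gain X v w x \<and> walk_gain Y v w y \<and> x \<otimes> inv y \<in> H"
    using walk_gain_mono[OF Int_lower1 XE x] walk_gain_mono[OF Int_lower2 YE x] by blast
qed

text \<open>
  The element \<open>g\<close> is the gain of a closed walk that goes to the extra vertex \<open>u\<close> in \<open>X\<close> and
  returns in \<open>Y\<close>.
\<close>

lemma gain_group_Un_subset_extra:
  assumes X: "X \<in> connected_edge_sets G" and Y: "Y \<in> connected_edge_sets G"
    and F: "X \<inter> Y \<in> connected_edge_sets G" and V: "V X \<inter> V Y = insert u (V (X \<inter> Y))"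
    and v: "v \<in> V (X \<inter> Y)"
  obtains g where "g \<in> carrier \<Gamma>"
    "\<And>H. subgroup H \<Gamma> \<Longrightarrow> gain_group \<Gamma> G \<psi> X v \<subseteq> H \<Longrightarrow> gain_group \<Gamma> G \<psi> Y v \<subseteq> H \<Longrightarrow> g \<in> H \<Longrightarrow>
       gain_group \<Gamma> G \<psi> (X \<union> Y) v \<subseteq> H"
proof -
  note XE = connectedD(1)[OF X] and YE = connectedD(1)[OF Y]
  have vXY: "v \<in> V X" "v \<in> V Y" and u: "u \<in> V X" "u \<in> V Y"
    using v V by auto
  obtain x y where x: "walk_gain X v u x" and y: "walk_gain Y v u y"
    using connectedD(3)[OF X vXY(1) u(1)] connectedD(3)[OF Y vXY(2) u(2)] by blast
  show thesis
  proof (rule that[of "x \<otimes> inv y"])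
    show "x \<otimes> inv y \<in> carrier \<Gamma>"
      using walk_gain_closed[OF XE x] walk_gain_closed[OF YE y] by simp
    fix H
    assume H: "subgroup H \<Gamma>" and sub: "gain_group \<Gamma> G \<psi> X v \<subseteq> H" "gain_group \<Gamma> G \<psi> Y v \<subseteq> H"
      and g: "x \<otimes> inv y \<in> H"
    show "gain_group \<Gamma> G \<psi> (X \<union> Y) v \<subseteq> H"
    proof (rule gain_group_Un[OF X Y vXY H sub])
      fix w
      assume "w \<in> V X" "w \<in> V Y"
      then consider "w = u" | "w \<in> V (X \<inter> Y)"
        using V by blast
      then show "\<exists>x y. walk_gain X v w x \<and> walk_gain Y v w y \<and> x \<otimes> inv y \<in> H"
      proof cases
        case 1
        then show ?thesis
          using x y g by blast
      next
        case 2
        then obtain z where z: "walk_gain (X \<inter> Y) v w z"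
          using connectedD(3)[OF F v] by blast
        have "z \<otimes> inv z \<in> H"
          using walk_gain_closed[OF connectedD(1)[OF F] z] subgroup.one_closed[OF H] by simp
        then show ?thesis
          using walk_gain_mono[OF Int_lower1 XE z] walk_gain_mono[OF Int_lower2 YE z] by blast
      qed
    qed
  qed
qed

end

context count_function
begin

lemma alpha_tilde_le_generators:
  assumes "F \<in> conn" "v \<in> V F" "S \<subseteq> carrier \<Gamma>" "gains F v \<subseteq> generate \<Gamma> S"
  shows "group_rank F \<le> \<alpha> S"
  using alpha_mono[OF assms(4) generate_incl[OF assms(3)]] alpha_generate[OF assms(3)]
    alpha_tilde_base[OF assms(1,2)] by simp

lemma conn_Un:
  assumes "X \<in> conn" "Y \<in> conn" "X \<inter> Y \<noteq> {}"
  shows "X \<union> Y \<in> conn"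
proof -
  obtain e where "e \<in> X" "e \<in> Y"
    using assms(3) by blast
  then show ?thesis
    using connected_Un[OF assms(1,2), of "tail G e"] by simp
qed

lemma V_in_verts: "F \<subseteq> arcs G \<Longrightarrow> V F \<subseteq> verts G"
  by (auto simp: edge_verts_def)

lemma card_V_Un:
  assumes "X \<subseteq> arcs G" "Y \<subseteq> arcs G"
  shows "k * int (card (V (X \<union> Y))) + k * int (card (V X \<inter> V Y)) =
    k * int (card (V X)) + k * int (card (V Y))"
proof -
  have "int (card (V (X \<union> Y))) + int (card (V X \<inter> V Y)) = int (card (V X)) + int (card (V Y))"
    using card_Un_Int[OF finite_V[OF assms(1)] finite_V[OF assms(2)]] by (simp add: V_Un)
  then show ?thesis
    by (metis distrib_left)
qed

definition uncrosses :: "'e set \<Rightarrow> 'e set \<Rightarrow> 'e set \<Rightarrow> bool" where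
  "uncrosses I X Y \<longleftrightarrow> int (card (I \<inter> (X \<inter> Y))) + count (X \<union> Y) \<le> count X + count Y"

lemma uncrosses_sym: "uncrosses I X Y \<longleftrightarrow> uncrosses I Y X"
  by (simp add: uncrosses_def Un_commute Int_commute add.commute)

text \<open>
  The bounds for \<open>I \<inter> P\<close> and \<open>I \<inter> Q\<close> together contain \<open>2 l\<close>, and \<open>\<beta> (X \<union> Y) \<le> l\<close>.
\<close>

lemma uncrosses_by_partition:
  assumes I: "I \<in> indep" and X: "X \<in> conn" and Y: "Y \<in> conn"
    and nonloop: "\<And>e. e \<in> X \<Longrightarrow> {e} \<in> indep"
    and PQ: "X \<inter> Y = P \<union> Q" "P \<inter> Q = {}" "P \<noteq> {}" "Q \<noteq> {}" and s: "card (V P \<inter> V Q) \<le> s"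
    and b: "b \<le> l" "b' \<le> l"
    and bP: "\<And>C. C \<in> conn \<Longrightarrow> C \<subseteq> P \<Longrightarrow> \<beta> C \<le> b"
    and bQ: "\<And>C. C \<in> conn \<Longrightarrow> C \<subseteq> Q \<Longrightarrow> \<beta> C \<le> b'"
    and sum: "b + b' + k * int s \<le> \<beta> X + \<beta> Y"
  shows "uncrosses I X Y"
proof -
  note XE = connectedD(1)[OF X] and YE = connectedD(1)[OF Y]
  have PE: "P \<subseteq> X" "P \<subseteq> Y" "P \<subseteq> arcs G" and QE: "Q \<subseteq> X" "Q \<subseteq> Y" "Q \<subseteq> arcs G"
    using PQ(1) XE by auto
  have "X \<union> Y \<in> conn"
    using conn_Un[OF X Y] PQ by blast
  then have "\<beta> (X \<union> Y) \<le> l"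
    using beta_bounds by blast
  moreover have "int (card (I \<inter> P)) \<le> k * int (card (V P)) - l + b"
    using nonloop PE by (intro card_independent_Int_le[OF I b(1) PE(3) PQ(3) _ bP]) auto
  moreover have "int (card (I \<inter> Q)) \<le> k * int (card (V Q)) - l + b'"
    using nonloop QE by (intro card_independent_Int_le[OF I b(2) QE(3) PQ(4) _ bQ]) auto
  moreover have "card (I \<inter> (X \<inter> Y)) \<le> card (I \<inter> P) + card (I \<inter> Q)"
    unfolding PQ(1) Int_Un_distrib by (rule card_Un_le)
  moreover have "k * int (card (V P)) + k * int (card (V Q)) \<le> k * int (card (V X \<inter> V Y)) + k * int s"
  proof -
    have "V P \<union> V Q \<subseteq> V X \<inter> V Y"
      using V_mono PE QE by blast
    then have "card (V P \<union> V Q) \<le> card (V X \<inter> V Y)"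
      using finite_V[OF XE] by (intro card_mono) auto
    then have "int (card (V P)) + int (card (V Q)) \<le> int (card (V X \<inter> V Y)) + int s"
      using card_Un_Int[OF finite_V[OF PE(3)] finite_V[OF QE(3)]] s by linarith
    then show ?thesis
      using mult_left_mono[of _ _ k] k_pos by (fastforce simp: distrib_left)
  qed
  ultimately show ?thesis
    using card_V_Un[OF XE YE] sum unfolding uncrosses_def count_eq by linarith
qed

text \<open>
  Each common vertex of \<open>X\<close> and \<open>Y\<close> outside of \<open>X \<inter> Y\<close> leaves room for \<open>k\<close>.
\<close>

lemma uncrosses_if_connected:
  assumes I: "I \<in> indep" and X: "X \<in> conn" and Y: "Y \<in> conn"
    and nonloop: "\<And>e. e \<in> X \<Longrightarrow> {e} \<in> indep" and F: "X \<inter> Y \<in> conn"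
    and d: "card (V (X \<inter> Y)) + d \<le> card (V X \<inter> V Y)"
    and sum: "\<beta> (X \<union> Y) + \<beta> (X \<inter> Y) \<le> \<beta> X + \<beta> Y + k * int d"
  shows "uncrosses I X Y"
proof -
  note XE = connectedD(1)[OF X] and YE = connectedD(1)[OF Y]
  have "int (card (I \<inter> (X \<inter> Y))) \<le> k * int (card (V (X \<inter> Y))) - l + \<beta> (X \<inter> Y)"
    using nonloop connectedD[OF F] beta_bounds[OF F] beta_mono[OF _ F]
    by (intro card_independent_Int_le[OF I]) auto
  moreover have "k * int (card (V (X \<inter> Y))) + k * int d \<le> k * int (card (V X \<inter> V Y))"
    using mult_left_mono[of "int (card (V (X \<inter> Y)) + d)" "int (card (V X \<inter> V Y))" k] d k_pos
    by (simp add: distrib_left)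
  ultimately show ?thesis
    using card_V_Un[OF XE YE] sum unfolding uncrosses_def count_eq by linarith
qed

lemma beta_add_uncapped:
  assumes X: "X \<in> conn" and Y: "Y \<in> conn" and F: "X \<inter> Y \<in> conn"
    and V: "V X \<inter> V Y = V (X \<inter> Y)" and uncapped: "\<not> capped X" "\<not> capped Y"
  shows "\<beta> (X \<union> Y) + \<beta> (X \<inter> Y) \<le> \<beta> X + \<beta> Y"
proof -
  obtain v where v: "v \<in> V (X \<inter> Y)"
    using conn_vertex[OF F] .
  then have vXY: "v \<in> V X" "v \<in> V Y" "v \<in> V (X \<union> Y)"
    using V by (auto simp: V_Un)
  have XY: "X \<union> Y \<in> conn"
    using conn_Un[OF X Y] connectedD(2)[OF F] .
  let ?A = "gains X v" and ?B = "gains Y v"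
  have AB: "?A \<subseteq> carrier \<Gamma>" "?B \<subseteq> carrier \<Gamma>"
    using gains_carrier X Y vXY by auto
  have "gains (X \<union> Y) v \<subseteq> generate \<Gamma> (?A \<union> ?B)"
    using AB generate.incl[of _ "?A \<union> ?B" \<Gamma>]
    by (intro gain_group_Un_subset[OF X Y F V v generate_is_subgroup]) auto
  then have "group_rank (X \<union> Y) \<le> \<alpha> (?A \<union> ?B)"
    using AB by (intro alpha_tilde_le_generators[OF XY vXY(3)]) auto
  moreover have "gains (X \<inter> Y) v \<subseteq> ?A \<inter> ?B"
    using gain_group_mono[OF Int_lower1 connectedD(1)[OF X] v]
      gain_group_mono[OF Int_lower2 connectedD(1)[OF Y] v] by blast
  then have "group_rank (X \<inter> Y) \<le> \<alpha> (?A \<inter> ?B)"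
    using alpha_mono[of "gains (X \<inter> Y) v" "?A \<inter> ?B"] AB alpha_tilde_base[OF F v]
    by (metis le_infI1)
  ultimately show ?thesis
    using alpha_submodular[OF AB] alpha_tilde_base[OF X vXY(1)] alpha_tilde_base[OF Y vXY(2)]
      beta_le_alpha_tilde[of "X \<union> Y"] beta_le_alpha_tilde[of "X \<inter> Y"] uncapped
    by (simp add: beta_capped[of X] beta_capped[of Y])
qed

text \<open>
  Smoothness is applied to the gain group of \<open>X\<close>, which is nontrivial as \<open>X\<close> is unbalanced.
\<close>

lemma beta_add_extra_unbalanced:
  assumes X: "X \<in> conn" and Y: "Y \<in> conn" and F: "X \<inter> Y \<in> conn"
    and V: "V X \<inter> V Y = insert u (V (X \<inter> Y))" and uncapped: "\<not> capped X" "\<not> capped Y"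
    and unb: "\<not> bal X"
  shows "\<beta> (X \<union> Y) + \<beta> (X \<inter> Y) \<le> \<beta> X + \<beta> Y + k"
proof -
  obtain v where v: "v \<in> V (X \<inter> Y)"
    using conn_vertex[OF F] .
  then have vXY: "v \<in> V X" "v \<in> V Y" "v \<in> V (X \<union> Y)"
    using V by (auto simp: V_Un)
  have XY: "X \<union> Y \<in> conn"
    using conn_Un[OF X Y] connectedD(2)[OF F] .
  obtain g where g: "g \<in> carrier \<Gamma>" and gen:
    "\<And>H. subgroup H \<Gamma> \<Longrightarrow> gains X v \<subseteq> H \<Longrightarrow> gains Y v \<subseteq> H \<Longrightarrow> g \<in> H \<Longrightarrow> gains (X \<union> Y) v \<subseteq> H"
    using gain_group_Un_subset_extra[OF X Y F V v] by blast
  let ?A = "gains X v" and ?B = "gains Y v"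
  have AB: "?A \<subseteq> carrier \<Gamma>" "?B \<subseteq> carrier \<Gamma>" "?A \<union> {g} \<subseteq> carrier \<Gamma>"
    using gains_carrier X Y vXY g by auto
  have "gains (X \<union> Y) v \<subseteq> generate \<Gamma> (?A \<union> {g} \<union> ?B)"
    using AB generate.incl[of _ "?A \<union> {g} \<union> ?B" \<Gamma>]
    by (intro gen generate_is_subgroup) auto
  then have "group_rank (X \<union> Y) \<le> \<alpha> (?A \<union> {g} \<union> ?B)"
    using AB by (intro alpha_tilde_le_generators[OF XY vXY(3)]) auto
  moreover have "gains (X \<inter> Y) v \<subseteq> (?A \<union> {g}) \<inter> ?B"
    using gain_group_mono[OF Int_lower1 connectedD(1)[OF X] v]
      gain_group_mono[OF Int_lower2 connectedD(1)[OF Y] v] by blast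
  then have "group_rank (X \<inter> Y) \<le> \<alpha> ((?A \<union> {g}) \<inter> ?B)"
    using alpha_mono[of "gains (X \<inter> Y) v" "(?A \<union> {g}) \<inter> ?B"] AB alpha_tilde_base[OF F v]
    by (metis le_infI1)
  moreover have "\<alpha> (?A \<union> {g}) \<le> \<alpha> ?A + k"
  proof (rule alpha_insert[OF _ _ AB(1) g])
    show "?A \<noteq> {}"
      using subgroup.one_closed[OF subgroup_gain_group[OF connectedD(1)[OF X] vXY(1)]] by blast
    show "?A \<noteq> {\<one>}"
      using gain_group_trivial_iff[OF X vXY(1)] unb by blast
  qed
  ultimately show ?thesis
    using alpha_submodular[OF AB(3,2)] alpha_tilde_base[OF X vXY(1)] alpha_tilde_base[OF Y vXY(2)]
      beta_le_alpha_tilde[of "X \<union> Y"] beta_le_alpha_tilde[of "X \<inter> Y"] uncapped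
    by (simp add: beta_capped[of X] beta_capped[of Y])
qed

text \<open>
  When one of the sets is capped, its \<open>\<beta>\<close>-value \<open>k\<close> and the additional \<open>k\<close> exceed \<open>\<beta> (X \<union> Y) \<le> l\<close>,
  and the other set has a larger \<open>\<beta>\<close>-value than \<open>X \<inter> Y\<close>, or the same. When both sets are balanced,
  so is their union after a split of \<open>u\<close>.
\<close>

lemma beta_add_extra:
  assumes X: "X \<in> conn" and Y: "Y \<in> conn" and F: "X \<inter> Y \<in> conn"
    and V: "V X \<inter> V Y = insert u (V (X \<inter> Y))"
  shows "\<beta> (X \<union> Y) + \<beta> (X \<inter> Y) \<le> \<beta> X + \<beta> Y + k"
proof -
  have XY: "X \<union> Y \<in> conn"
    using conn_Un[OF X Y] connectedD(2)[OF F] .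
  note mono = beta_mono[OF F X Int_lower1] beta_mono[OF F Y Int_lower2]
  consider "capped X \<or> capped Y" | "\<not> capped X" "\<not> capped Y" "\<not> bal X"
    | "\<not> capped X" "\<not> capped Y" "\<not> bal Y" | "bal X" "bal Y"
    by blast
  then show ?thesis
  proof cases
    case 1
    then have "\<beta> X = k \<or> \<beta> Y = k"
      using beta_capped by auto
    then show ?thesis
      using mono beta_bounds[OF XY] l_less by linarith
  next
    case 2
    then show ?thesis
      using beta_add_extra_unbalanced[OF X Y F V] by blast
  next
    case 3
    have "Y \<inter> X \<in> conn" "V Y \<inter> V X = insert u (V (Y \<inter> X))"
      using F V by (simp_all add: Int_commute)
    from beta_add_extra_unbalanced[OF Y X this] 3 show ?thesis
      by (simp add: Int_commute Un_commute)
  next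
    case 4
    obtain p q where p: "potential p X" and q: "potential q Y"
      using 4 balanced_iff_potential connectedD(1) X Y by metis
    obtain r1 r2 where "split_potential u r1 r2 (X \<union> Y)"
      using balanced_glue_extra_vertex[OF F connectedD(1)[OF Y] p q V] by blast
    moreover have "u \<in> verts G"
      using V V_in_verts[OF connectedD(1)[OF X]] by blast
    ultimately have "\<beta> (X \<union> Y) \<le> k"
      using beta_split[OF XY] by blast
    then show ?thesis
      using mono beta_balanced[OF X 4(1)] beta_bounds[OF Y] by linarith
  qed
qed

text \<open>
  Here \<open>\<beta> X = k\<close> and \<open>\<beta> (X \<inter> Y) = 0\<close>, so it suffices that \<open>\<beta> (X \<union> Y)\<close> exceeds \<open>\<beta> Y\<close> by at most
  \<open>k\<close>. If \<open>Y\<close> is balanced, either \<open>X \<union> Y\<close> has a split or a cut vertex divides \<open>X \<inter> Y\<close>. If \<open>Y\<close> is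
  capped, \<open>2 k\<close> is more than \<open>l\<close>. Otherwise the cyclic gain group of \<open>X\<close> adds one generator to the
  nontrivial gain group of \<open>Y\<close>.
\<close>

lemma uncrosses_capped_balanced_meet:
  assumes I: "I \<in> indep" and X: "X \<in> conn" and Y: "Y \<in> conn"
    and nonloop: "\<And>e. e \<in> X \<Longrightarrow> {e} \<in> indep" and F: "X \<inter> Y \<in> conn"
    and V: "V X \<inter> V Y = V (X \<inter> Y)" and cap: "capped X" and bal: "bal (X \<inter> Y)"
  shows "uncrosses I X Y"
proof -
  have XY: "X \<union> Y \<in> conn"
    using conn_Un[OF X Y] connectedD(2)[OF F] .
  have bX: "\<beta> X = k" and bF: "\<beta> (X \<inter> Y) = 0"
    using cap beta_capped beta_balanced[OF F bal] by auto
  have direct: "uncrosses I X Y" if "\<beta> (X \<union> Y) \<le> k + \<beta> Y"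
    using that bX bF V by (intro uncrosses_if_connected[OF I X Y nonloop F, of 0]) auto
  obtain v p1 p2 where v: "v \<in> verts G" "v \<in> V X" and p: "split_potential v p1 p2 X"
    and ne: "p1 v \<noteq> p2 v"
    using cappedE[OF cap] by metis
  have c: "p1 w \<in> carrier \<Gamma>" "p2 w \<in> carrier \<Gamma>" for w
    using split_potential_closed[OF p] by auto
  consider "bal Y" | "capped Y" | "\<not> bal Y" "\<not> capped Y"
    by blast
  then show ?thesis
  proof cases
    case 1
    then obtain q where q: "potential q Y"
      using balanced_iff_potential[OF connectedD(1)[OF Y]] by blast
    from split_or_cut_vertex_if_balanced[OF F connectedD(1)[OF Y] p ne q V]
    show ?thesis
    proof (elim disjE exE conjE)
      fix r1 r2
      assume "split_potential v r1 r2 (X \<union> Y)"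
      then show ?thesis
        using direct beta_split[OF XY v(1)] beta_bounds[OF Y] by fastforce
    next
      fix P Q
      assume PQ: "X \<inter> Y = P \<union> Q" "P \<inter> Q = {}" "P \<noteq> {}" "Q \<noteq> {}" and sh: "V P \<inter> V Q \<subseteq> {v}"
      have "card (V P \<inter> V Q) \<le> 1"
        using card_mono[OF _ sh] by simp
      moreover have "\<beta> C \<le> 0" if "C \<in> conn" "C \<subseteq> P \<or> C \<subseteq> Q" for C
      proof -
        have "C \<subseteq> X \<inter> Y"
          using that(2) PQ(1) by blast
        then show ?thesis
          using beta_balanced[OF that(1) balanced_mono[OF bal]] by simp
      qed
      ultimately show ?thesis
        using bX beta_bounds[OF Y] l_nonneg
        by (intro uncrosses_by_partition[OF I X Y nonloop PQ, of 1 0 0]) auto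
    qed
  next
    case 2
    then show ?thesis
      using direct beta_capped[of Y] beta_bounds[OF XY] l_less by simp
  next
    case 3
    obtain b where b: "b \<in> V (X \<inter> Y)"
      using conn_vertex[OF F] .
    then have bXY: "b \<in> V X" "b \<in> V Y" "b \<in> V (X \<union> Y)"
      using V by (auto simp: V_Un)
    define g where "g = inv (p1 b) \<otimes> p2 v \<otimes> inv (p1 v) \<otimes> p1 b"
    have g: "g \<in> carrier \<Gamma>"
      using c by (simp add: g_def)
    let ?B = "gains Y b"
    have B: "?B \<subseteq> carrier \<Gamma>" "?B \<union> {g} \<subseteq> carrier \<Gamma>"
      using gains_carrier[OF Y bXY(2)] g by auto
    have "gains X b \<subseteq> generate \<Gamma> {g}"
      using gain_group_split[OF connectedD(1)[OF X] p bXY(1)] by (simp add: g_def)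
    also have "\<dots> \<subseteq> generate \<Gamma> (?B \<union> {g})"
      by (rule mono_generate) simp
    finally have "gains (X \<union> Y) b \<subseteq> generate \<Gamma> (?B \<union> {g})"
      using generate.incl[of _ "?B \<union> {g}" \<Gamma>]
      by (intro gain_group_Un_subset[OF X Y F V b generate_is_subgroup[OF B(2)]]) auto
    then have "group_rank (X \<union> Y) \<le> \<alpha> (?B \<union> {g})"
      by (rule alpha_tilde_le_generators[OF XY bXY(3) B(2)])
    also have "\<dots> \<le> \<alpha> ?B + k"
    proof (rule alpha_insert[OF _ _ B(1) g])
      show "?B \<noteq> {}"
        using subgroup.one_closed[OF subgroup_gain_group[OF connectedD(1)[OF Y] bXY(2)]] by blast
      show "?B \<noteq> {\<one>}"
        using gain_group_trivial_iff[OF Y bXY(2)] 3(1) by blast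
    qed
    also have "\<alpha> ?B = \<beta> Y"
      using 3(2) alpha_tilde_base[OF Y bXY(2)] by (simp add: beta_capped)
    finally show ?thesis
      using direct beta_le_alpha_tilde[of "X \<union> Y"] by simp
  qed
qed

text \<open>
  The unbalanced set \<open>X \<inter> Y\<close> has the same gain group as \<open>X\<close>, so \<open>X \<union> Y\<close> has the same gain group as
  \<open>Y\<close>. This settles the matter unless \<open>Y\<close> is capped too; then the two splits are compared.
\<close>

lemma uncrosses_capped_unbalanced_meet:
  assumes I: "I \<in> indep" and X: "X \<in> conn" and Y: "Y \<in> conn"
    and nonloop: "\<And>e. e \<in> X \<Longrightarrow> {e} \<in> indep" and F: "X \<inter> Y \<in> conn"
    and V: "V X \<inter> V Y = V (X \<inter> Y)" and cap: "capped X" and unb: "\<not> bal (X \<inter> Y)"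
  shows "uncrosses I X Y"
proof -
  have XY: "X \<union> Y \<in> conn"
    using conn_Un[OF X Y] connectedD(2)[OF F] .
  have bX: "\<beta> X = k"
    using cap beta_capped by auto
  have kl: "k \<le> l"
    using beta_bounds[OF X] bX by simp
  note mono = beta_mono[OF F X Int_lower1] beta_mono[OF F Y Int_lower2]
  have direct: "uncrosses I X Y" if "\<beta> (X \<union> Y) \<le> \<beta> Y"
    using that mono V by (intro uncrosses_if_connected[OF I X Y nonloop F, of 0]) auto
  obtain v p1 p2 where v: "v \<in> verts G" "v \<in> V X" and p: "split_potential v p1 p2 X"
    and sq: "(inv (p1 v) \<otimes> p2 v) \<otimes> (inv (p1 v) \<otimes> p2 v) \<noteq> \<one>" and ne: "p1 v \<noteq> p2 v"
    and gen: "gains X v \<subseteq> generate \<Gamma> {inv (p1 v) \<otimes> p2 v}"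
    using cappedE[OF cap] by metis
  note pF = split_potential_mono[OF p Int_lower1, of Y]
  have vF: "v \<in> V (X \<inter> Y)" and gF: "inv (p1 v) \<otimes> p2 v \<in> gains (X \<inter> Y) v"
    using unbalanced_subset_generator[OF F pF unb] .
  then have vXY: "v \<in> V Y" "v \<in> V (X \<union> Y)"
    using V by (auto simp: V_Un)
  show ?thesis
  proof (cases "capped Y")
    case False
    have sub: "subgroup (gains Y v) \<Gamma>"
      using subgroup_gain_group[OF connectedD(1)[OF Y] vXY(1)] .
    have "inv (p1 v) \<otimes> p2 v \<in> gains Y v"
      using gF gain_group_mono[OF Int_lower2 connectedD(1)[OF Y] vF] by blast
    then have "gains X v \<subseteq> gains Y v"
      using gen generate_subgroup_incl[OF _ sub, of "{inv (p1 v) \<otimes> p2 v}"] by simp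
    then have "gains (X \<union> Y) v \<subseteq> gains Y v"
      using gain_group_Un_subset[OF X Y F V vF sub] by blast
    then have "group_rank (X \<union> Y) \<le> group_rank Y"
      using alpha_mono[OF _ gains_carrier[OF Y vXY(1)]] alpha_tilde_base[OF XY vXY(2)]
        alpha_tilde_base[OF Y vXY(1)] by simp
    then show ?thesis
      using direct beta_le_alpha_tilde[of "X \<union> Y"] False by (simp add: beta_capped[of Y])
  next
    case True
    then have bY: "\<beta> Y = k"
      using beta_capped by auto
    obtain w q1 q2 where w: "w \<in> verts G" and q: "split_potential w q1 q2 Y" and ne': "q1 w \<noteq> q2 w"
      using cappedE[OF True] by metis
    show ?thesis
    proof (cases "w = v")
      case True
      from split_or_cut_vertex[OF connectedD(1)[OF X] p q[unfolded True] sq ne'[unfolded True] unb V]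
      show ?thesis
      proof (elim disjE exE conjE)
        fix r1 r2
        assume "split_potential v r1 r2 (X \<union> Y)"
        then show ?thesis
          using direct bY beta_split[OF XY v(1)] by simp
      next
        fix P Q
        assume PQ: "X \<inter> Y = P \<union> Q" "P \<inter> Q = {}" "P \<noteq> {}" "Q \<noteq> {}" and sh: "V P \<inter> V Q \<subseteq> {v}"
          and P: "bal P"
        have "card (V P \<inter> V Q) \<le> 1"
          using card_mono[OF _ sh] by simp
        moreover have "\<beta> C \<le> 0" if "C \<in> conn" "C \<subseteq> P" for C
          using beta_balanced[OF that(1) balanced_mono[OF P that(2)]] by simp
        moreover have "\<beta> C \<le> k" if "C \<in> conn" "C \<subseteq> Q" for C
          using beta_mono[OF that(1) X] that(2) PQ(1) bX by auto
        ultimately show ?thesis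
          using bX bY l_nonneg kl
          by (intro uncrosses_by_partition[OF I X Y nonloop PQ, of 1 0 k]) auto
      qed
    next
      case False
      obtain P Q where PQ: "X \<inter> Y = P \<union> Q" "P \<inter> Q = {}" "P \<noteq> {}" "Q \<noteq> {}"
        and sh: "V P \<inter> V Q \<subseteq> {v, w}" and bal: "bal P" "bal Q"
        using two_balanced_parts[OF connectedD(1)[OF F] pF split_potential_mono[OF q Int_lower2]
            ne not_sym[OF False] unb] by metis
      have "card (V P \<inter> V Q) \<le> card {v, w}"
        using card_mono[OF _ sh] by simp
      also have "\<dots> \<le> 2"
        by (simp add: card_insert_if)
      finally have "card (V P \<inter> V Q) \<le> 2" .
      moreover have "\<beta> C \<le> 0" if "C \<in> conn" "C \<subseteq> P" for C
        using beta_balanced[OF that(1) balanced_mono[OF bal(1) that(2)]] by simp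
      moreover have "\<beta> C \<le> 0" if "C \<in> conn" "C \<subseteq> Q" for C
        using beta_balanced[OF that(1) balanced_mono[OF bal(2) that(2)]] by simp
      ultimately show ?thesis
        using bX bY l_nonneg
        by (intro uncrosses_by_partition[OF I X Y nonloop PQ, of 2 0 0]) auto
    qed
  qed
qed

text \<open>
  The cases are distinguished by the number of common vertices of \<open>X\<close> and \<open>Y\<close> that are not
  vertices of \<open>X \<inter> Y\<close>.
\<close>

theorem uncrossing:
  assumes I: "I \<in> indep" and X: "X \<in> conn" and Y: "Y \<in> conn" and meet: "X \<inter> Y \<noteq> {}"
    and nonloop: "\<And>e. e \<in> X \<union> Y \<Longrightarrow> {e} \<in> indep"
  shows "uncrosses I X Y"
proof (cases "X \<inter> Y \<in> conn")
  case False
  have "X \<inter> Y \<subseteq> arcs G"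
    using connectedD(1)[OF X] by blast
  then obtain P Q where PQ: "X \<inter> Y = P \<union> Q" "P \<inter> Q = {}" "P \<noteq> {}" "Q \<noteq> {}"
    and sh: "V P \<inter> V Q = {}"
    using disconnected_split[OF _ meet False] by blast
  have "\<beta> C \<le> \<beta> X" "\<beta> C \<le> \<beta> Y" if "C \<in> conn" "C \<subseteq> P \<or> C \<subseteq> Q" for C
    using beta_mono[OF that(1) X] beta_mono[OF that(1) Y] that(2) PQ(1) by blast+
  then show ?thesis
    using nonloop beta_bounds[OF X] beta_bounds[OF Y] sh
    by (intro uncrosses_by_partition[OF I X Y _ PQ, of 0 "\<beta> X" "\<beta> Y"]) auto
next
  case F: True
  note XE = connectedD(1)[OF X]
  have XY: "X \<union> Y \<in> conn"
    using conn_Un[OF X Y meet] .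
  have nl: "{e} \<in> indep" if "e \<in> X \<or> e \<in> Y" for e
    using nonloop that by blast
  have sub: "V (X \<inter> Y) \<subseteq> V X \<inter> V Y"
    using V_mono by blast
  have fin: "finite (V X \<inter> V Y)"
    using finite_V[OF XE] by blast
  note mono = beta_mono[OF F X Int_lower1]
  define D where "D = (V X \<inter> V Y) - V (X \<inter> Y)"
  have card: "card (V X \<inter> V Y) = card (V (X \<inter> Y)) + card D"
    using card_Diff_subset[OF finite_subset[OF sub fin] sub] card_mono[OF fin sub]
    by (simp add: D_def)
  consider "2 \<le> card D" | "card D = 1" | "card D = 0"
    by linarith
  then show ?thesis
  proof cases
    case 1
    then show ?thesis
      using card mono beta_bounds[OF XY] beta_bounds[OF Y] l_less nl
      by (intro uncrosses_if_connected[OF I X Y _ F, of 2]) auto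
  next
    case 2
    then obtain u where "D = {u}"
      by (auto simp: card_Suc_eq One_nat_def)
    then have "V X \<inter> V Y = insert u (V (X \<inter> Y))"
      using sub by (auto simp: D_def)
    then show ?thesis
      using beta_add_extra[OF X Y F] card 2 nl
      by (intro uncrosses_if_connected[OF I X Y _ F, of 1]) auto
  next
    case 3
    then have V: "V X \<inter> V Y = V (X \<inter> Y)"
      using sub fin by (auto simp: D_def)
    have F': "Y \<inter> X \<in> conn" and V': "V Y \<inter> V X = V (Y \<inter> X)"
      using F V by (simp_all add: Int_commute)
    consider "capped X" | "capped Y" | "\<not> capped X" "\<not> capped Y"
      by blast
    then show ?thesis
    proof cases
      case 1
      then show ?thesis
        using uncrosses_capped_balanced_meet[OF I X Y _ F V] nl
          uncrosses_capped_unbalanced_meet[OF I X Y _ F V] by blast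
    next
      case 2
      then have "uncrosses I Y X"
        using uncrosses_capped_balanced_meet[OF I Y X _ F' V'] nl
          uncrosses_capped_unbalanced_meet[OF I Y X _ F' V'] by blast
      then show ?thesis
        by (simp add: uncrosses_sym)
    next
      case 3
      then show ?thesis
        using beta_add_uncapped[OF X Y F V] card nl V
        by (intro uncrosses_if_connected[OF I X Y _ F, of 0]) auto
    qed
  qed
qed

section \<open>The matroid\<close>

text \<open>
  An inequality, not an equation: a connected set with \<open>X \<inter> I\<close> empty and \<open>count X \<le> 0\<close> is tight as
  well. An edge that is dependent on its own lies in such a set.
\<close>

definition tight :: "'e set \<Rightarrow> 'e set set" where
  "tight I = {X \<in> conn. count X \<le> int (card (I \<inter> X))}"

lemma tight_Un:
  assumes I: "I \<in> indep" and "X \<in> tight I" "Y \<in> tight I" "X \<inter> Y \<noteq> {}"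
    and nonloop: "\<And>e. e \<in> X \<union> Y \<Longrightarrow> {e} \<in> indep"
  shows "X \<union> Y \<in> tight I"
proof -
  have X: "X \<in> conn" and Y: "Y \<in> conn"
    using assms by (auto simp: tight_def)
  have fin: "finite (I \<inter> X)" "finite (I \<inter> Y)"
    using indepD(1)[OF I] finite_arcs_subset by blast+
  have "(I \<inter> X) \<union> (I \<inter> Y) = I \<inter> (X \<union> Y)" "(I \<inter> X) \<inter> (I \<inter> Y) = I \<inter> (X \<inter> Y)"
    by auto
  then have "card (I \<inter> X) + card (I \<inter> Y) = card (I \<inter> (X \<union> Y)) + card (I \<inter> (X \<inter> Y))"
    using card_Un_Int[OF fin] by simp
  moreover have "uncrosses I X Y"
    using uncrossing[OF I X Y assms(4) nonloop] .
  ultimately show ?thesis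
    using assms(2,3) conn_Un[OF X Y assms(4)] unfolding tight_def uncrosses_def by simp
qed

lemma dependent_insert_tight:
  assumes I: "I \<in> indep" and e: "e \<in> arcs G" "e \<notin> I" and dep: "insert e I \<notin> indep"
  obtains X where "X \<in> tight I" "e \<in> X" "X \<subseteq> insert e I"
proof -
  have "insert e I \<subseteq> arcs G"
    using indepD(1)[OF I] e(1) by blast
  then obtain X where X: "X \<in> conn" "X \<subseteq> insert e I" "\<not> int (card X) \<le> count X"
    using dep unfolding I_alpha_def by blast
  have "e \<in> X"
    using X indepD(2)[OF I X(1)] by blast
  then have "X = insert e (I \<inter> X)"
    using X(2) by blast
  moreover have "finite (I \<inter> X)"
    using indepD(1)[OF I] finite_arcs_subset by blast
  ultimately have "card X = card (I \<inter> X) + 1"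
    using e(2) by (metis IntD1 Suc_eq_plus1 card_insert_disjoint)
  then show thesis
    using that[of X] X \<open>e \<in> X\<close> by (simp add: tight_def)
qed

text \<open>
  The maximal tight subsets of \<open>I \<union> J\<close> are disjoint, and if no edge of \<open>J - I\<close> could be added to
  \<open>I\<close>, they would cover \<open>J - I\<close>. But \<open>J\<close> has at most as many elements as \<open>I\<close> in each of them, and
  the elements of \<open>J\<close> outside belong to \<open>I\<close>.
\<close>

theorem augmentation:
  assumes I: "I \<in> indep" and J: "J \<in> indep" and less: "card I < card J"
  shows "\<exists>e \<in> J - I. insert e I \<in> indep"
proof (rule ccontr)
  assume no: "\<not> ?thesis"
  have IE: "I \<subseteq> arcs G" and JE: "J \<subseteq> arcs G"
    using indepD(1) I J by auto
  have fin: "finite I" "finite J"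
    using finite_arcs_subset IE JE by auto
  have nonloop: "{e} \<in> indep" if "e \<in> I \<union> J" for e
    using that indep_subset[OF I, of "{e}"] indep_subset[OF J, of "{e}"] by blast
  define T where "T = {X \<in> tight I. X \<subseteq> I \<union> J}"
  define M where "M = {X \<in> T. \<forall>Y \<in> T. X \<subseteq> Y \<longrightarrow> Y = X}"
  have "finite T"
    using fin by (intro finite_subset[of T "Pow (I \<union> J)"]) (auto simp: T_def)
  then have finM: "finite M"
    by (simp add: M_def)
  have disj: "X \<inter> Y = {}" if XY: "X \<in> M" "Y \<in> M" "X \<noteq> Y" for X Y
  proof (rule ccontr)
    assume meet: "X \<inter> Y \<noteq> {}"
    have "X \<in> tight I" "Y \<in> tight I" "X \<union> Y \<subseteq> I \<union> J"
      using XY by (auto simp: M_def T_def)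
    then have "X \<union> Y \<in> T"
      using tight_Un[OF I _ _ meet] nonloop by (auto simp: T_def)
    moreover have "Z = X" if "Z \<in> T" "X \<subseteq> Z" for Z
      using that XY(1) by (simp add: M_def)
    moreover have "Z = Y" if "Z \<in> T" "Y \<subseteq> Z" for Z
      using that XY(2) by (simp add: M_def)
    ultimately have "X \<union> Y = X" "X \<union> Y = Y"
      by simp_all
    then show False
      using XY(3) by simp
  qed
  have cover: "J - I \<subseteq> \<Union>M"
  proof
    fix e
    assume e: "e \<in> J - I"
    have "e \<in> arcs G" "e \<notin> I" "insert e I \<notin> indep"
      using e no JE by auto
    from dependent_insert_tight[OF I this] obtain X where "X \<in> tight I" "e \<in> X" "X \<subseteq> insert e I" .
    then have X: "X \<in> T" "e \<in> X"
      using e by (auto simp: T_def)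
    obtain Y where "Y \<in> T" "X \<subseteq> Y" "\<forall>Z \<in> T. Y \<subseteq> Z \<longrightarrow> Y = Z"
      using finite_has_maximal2[OF \<open>finite T\<close> X(1)] by blast
    then show "e \<in> \<Union>M"
      using X(2) by (auto simp: M_def)
  qed
  have "card (J \<inter> X) \<le> card (I \<inter> X)" if "X \<in> M" for X
  proof -
    have X: "X \<in> conn" "count X \<le> int (card (I \<inter> X))" "X \<subseteq> I \<union> J"
      using that by (auto simp: M_def T_def tight_def)
    have "int (card (J \<inter> X)) \<le> k * int (card (V X)) - l + \<beta> X"
      using X nonloop connectedD(1,2)[OF X(1)] beta_bounds[OF X(1)] beta_mono[OF _ X(1)]
      by (intro card_independent_Int_le[OF J]) auto
    then show ?thesis
      using X(2) by (simp add: count_eq)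
  qed
  moreover have "card (S \<inter> \<Union>M) = (\<Sum>X\<in>M. card (S \<inter> X))" if "finite S" for S :: "'e set"
  proof -
    have "S \<inter> \<Union>M = (\<Union>X\<in>M. S \<inter> X)"
      by blast
    also have "card \<dots> = (\<Sum>X\<in>M. card (S \<inter> X))"
    proof (rule card_UN_disjoint)
      show "\<forall>X\<in>M. \<forall>Y\<in>M. X \<noteq> Y \<longrightarrow> (S \<inter> X) \<inter> (S \<inter> Y) = {}"
        using disj by blast
    qed (use finM that in auto)
    finally show ?thesis .
  qed
  ultimately have "card (J \<inter> \<Union>M) \<le> card (I \<inter> \<Union>M)"
    using fin by (simp add: sum_mono)
  moreover have "card (J - \<Union>M) \<le> card (I - \<Union>M)"
    using cover fin by (intro card_mono) auto
  ultimately show False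
    using less card_Int_Diff[OF fin(1), of "\<Union>M"] card_Int_Diff[OF fin(2), of "\<Union>M"] by linarith
qed

theorem matroid_indep: "matroid_independent_sets (arcs G) indep"
proof -
  have "{} \<in> indep"
    using connectedD(2) by (auto simp: I_alpha_def)
  then show ?thesis
    unfolding matroid_independent_sets_def
    using finite_edges indepD(1) indep_subset augmentation by blast
qed

end

theorem theorem4p1:
  fixes k l :: int
    and \<Gamma> :: "('g, 'm) monoid_scheme"
    and G :: "('v, 'e) pre_digraph"
    and \<psi> :: "'e \<Rightarrow> 'g"
    and \<alpha> :: "'g set \<Rightarrow> int"
  assumes "k \<ge> 1" and "0 \<le> l" and "l \<le> 2 * k - 1"
    and "group \<Gamma>"
    and "fin_digraph G" and "\<psi> ` arcs G \<subseteq> carrier \<Gamma>"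
    and "\<alpha> ` Pow (carrier \<Gamma>) \<subseteq> {0..l}"
    and "normalized_polymatroidal \<Gamma> \<alpha>"
    and "\<And>S g. S \<noteq> {} \<Longrightarrow> S \<subseteq> carrier \<Gamma> \<Longrightarrow> g \<in> carrier \<Gamma> \<Longrightarrow>
           \<alpha> (S \<union> {g}) - \<alpha> S > k \<Longrightarrow> S = {\<one>\<^bsub>\<Gamma>\<^esub>} \<and> g [^]\<^bsub>\<Gamma>\<^esub> (2::nat) \<noteq> \<one>\<^bsub>\<Gamma>\<^esub>"
  shows "matroid_independent_sets (arcs G) (I_alpha \<Gamma> G \<psi> k l \<alpha>)"
proof -
  interpret group \<Gamma>
    by fact
  interpret fin_digraph G
    by fact
  interpret count_function \<Gamma> G \<psi> k l \<alpha>
    by unfold_locales (use assms in \<open>auto simp: image_subset_iff\<close>)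
  show ?thesis
    by (rule matroid_indep)
qed

end
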